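(* Assume (A1)-(A4), let $\mu_*$ be the unique invariant probability measure of $\{P_t\}_{t\ge0}$, and let $g\in BL(X)$ satisfy $\langle g,\mu_*\rangle=0$. For any $p\in\mathbb{N}\cup\{\infty\}$, any $d\in[0,\infty)$, and each $i\in\{0,1\}$, the functions $\mathcal{I}^{(i)}_{g,p,d},\mathcal{S}^{(i)}_{g,p,d}:X\to[0,1]$ given by $$\mathcal{I}^{(i)}_{g,p,d}(x):=\mathbb{E}_x\left[\left|\liminf_{n\to\infty}\left(\frac1n\sum_{k=1}^n\left(Z_{2k+i}^2(g)\wedge p\right)\right)-d\right|\wedge1\right],$$ $$\mathcal{S}^{(i)}_{g,p,d}(x):=\mathbb{E}_x\left[\left|\limsup_{n\to\infty}\left(\frac1n\sum_{k=1}^n\left(Z_{2k+i}^2(g)\wedge p\right)\right)-d\right|\wedge1\right]$$ are continuous.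
   Context: $(X,\rho)$ is a complete separable metric space with Borel $\sigma$-field $\mathcal{B}(X)$. $BC(X)$ is the set of bounded continuous functions $X\to\mathbb{R}$. For $f:X\to\mathbb{R}$, $\operatorname{Lip} f:=\sup\{|f(x)-f(y)|/\rho(x,y): x\neq y\}$; $L(X)$ is the set of $f$ with $\operatorname{Lip} f<\infty$, and $BL(X)$ the set of bounded $f\in L(X)$. $\mathcal{M}_1(X)$ is the set of Borel probability measures on $X$; for $r>0$, $\mathcal{M}_{1,r}(X)$ is the set of $\nu\in\mathcal{M}_1(X)$ with $\int_X\rho(x_0,x)^r\,\nu(dx)<\infty$ for some (equivalently every) $x_0\in X$. $\delta_x$ is the Dirac measure at $x$, and $\langle f,\nu\rangle:=\int_X f\,d\nu$. For $\nu_1,\nu_2\in\mathcal{M}_{1,1}(X)$, $d_W(\nu_1,\nu_2):=\sup\{|\langle f,\nu_1\rangle-\langle f,\nu_2\rangle|: f\in L(X),\ \operatorname{Lip} f\le 1\}$. A Markov semigroup $\{P_t\}_{t\ge 0}$ is a family of stochastic kernels $P_t:X\times\mathcal{B}(X)\to[0,1]$ such that $(t,x)\mapsto P_t(x,A)$ is jointly measurable for each $A\in\mathcal{B}(X)$, $P_0(x,\cdot)=\delta_x$, and $P_{s+t}(x,A)=\int_X P_t(y,A)P_s(x,dy)$. Write $\nu P_t(A):=\int_X P_t(x,A)\,\nu(dx)$ and $P_tf(x):=\int_X f(y)P_t(x,dy)$. A measure $\nu\in\mathcal{M}_1(X)$ is invariant if $\nu P_t=\nu$ for all $t\ge0$.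 $\Phi=(\Omega,\mathcal{F},\{\mathcal{F}_t\}_{t\ge0},\{\Phi_t\}_{t\ge0},\{\theta_t\}_{t\ge0},\{\mathbb{P}_x\}_{x\in X})$ is a time-homogeneous, progressively measurable Markov process with state space $X$ and transition semigroup $\{P_t\}_{t\ge0}$: $\Phi_t:\Omega\to X$, $\mathcal{F}=\sigma(\Phi_s:s\ge0)$, $\mathcal{F}_t=\sigma(\Phi_s:0\le s\le t)$; $\theta_t:\Omega\to\Omega$ satisfies $\Phi_{s+t}=\Phi_s\circ\theta_t$; each $\mathbb{P}_x$ is a probability measure on $(\Omega,\mathcal{F})$ with $\mathbb{P}_x(\Phi_0=x)=1$, $\mathbb{P}_x(\Phi_{t+s}\in A\,|\,\mathcal{F}_s)=\mathbb{P}_{\Phi_s}(\Phi_t\in A)$ $\mathbb{P}_x$-a.s., and $\mathbb{P}_x(\Phi_t\in A)=P_t(x,A)$; and for each $t\geq 0$ the map $[0,t]\times\Omega\ni(s,\omega)\mapsto\Phi_s(\omega)$ is $\mathcal{B}([0,t])\otimes\mathcal{F}_t/\mathcal{B}(X)$-measurable. $\mathbb{E}_x$ is expectation under $\mathbb{P}_x$. Conditions: (A1) $\lim_{t\to0^+}P_tf(x)=f(x)$ for all $x\in X$, $f\in BC(X)$. (A2) $P_tf\in BC(X)$ for all $f\in BC(X)$, $t\ge0$. (A3) $\nu P_t\in\mathcal{M}_{1,1}(X)$ for all $\nu\in\mathcal{M}_{1,1}(X)$, $t>0$, and there is $\gamma\in(0,\infty)$ with $d_W(\delta_xP_t,\delta_yP_t)\le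 e^{-\gamma t}\rho(x,y)$ for all $t\ge0$, $x,y\in X$. (A4) For a given measure $\mu\in\mathcal{M}_1(X)$, there exist $x_0\in X$ and $\zeta\in(2,\infty)$ such that $\sup_{t\ge0}\langle V^\zeta,\mu P_t\rangle<\infty$, where $V:=\rho(x_0,\cdot)$. Under (A2)-(A4), $\{P_t\}_{t\ge0}$ has a unique invariant probability measure $\mu_*$, which belongs to $\mathcal{M}_{1,\zeta}(X)$, and for $g\in BL(X)$ with $\langle g,\mu_*\rangle=0$ the function $\chi_g(x):=\int_0^\infty P_tg(x)\,dt$ is well defined. Put $$Z_n(g):=\chi_g(\Phi_n)-\chi_g(\Phi_{n-1})+\int_{n-1}^ng(\Phi_s)\,ds,\quad n\in\mathbb{N}.$$ Here $a\wedge b:=\min(a,b)$, with $a\wedge\infty=a$ for real $a$ and $\infty\wedge1=1$. *)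

theory Defs
  imports "HOL-Probability.Probability"
begin

definition BC :: "('a::metric_space \<Rightarrow> real) set" where
  "BC = {f. continuous_on UNIV f \<and> bounded (range f)}"

text \<open>The supremum is taken in \<open>[0, \<infinity>]\<close>, so it is \<open>0\<close> on a one-point space.\<close>

definition Lip :: "('a::metric_space \<Rightarrow> real) \<Rightarrow> ennreal" where
  "Lip f = (SUP (x, y) \<in> {(x, y). x \<noteq> y}. ennreal (\<bar>f x - f y\<bar> / dist x y))"

definition BL :: "('a::metric_space \<Rightarrow> real) set" where
  "BL = {f. Lip f < \<infinity> \<and> bounded (range f)}"

definition M1 :: "'a::metric_space measure set" where
  "M1 = {\<nu>. prob_space \<nu> \<and> sets \<nu> = sets borel}"

definition M1_moment :: "real \<Rightarrow> 'a::metric_space measure set" where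
  "M1_moment r = {\<nu> \<in> M1. \<exists>x0. (\<integral>\<^sup>+ x. ennreal (dist x0 x powr r) \<partial>\<nu>) < \<infinity>}"

text \<open>The Wasserstein distance; only meaningful for measures in \<open>M1_moment 1\<close>, where
  all the integrals exist and the supremum is finite.\<close>

definition d_W :: "'a::metric_space measure \<Rightarrow> 'a measure \<Rightarrow> ennreal" where
  "d_W \<nu>1 \<nu>2 = (SUP f \<in> {f. Lip f \<le> 1}. ennreal \<bar>(\<integral>x. f x \<partial>\<nu>1) - (\<integral>x. f x \<partial>\<nu>2)\<bar>)"

text \<open>A kernel \<open>P\<^sub>t(x, A)\<close> is rendered as \<open>emeasure (P t x) A\<close>; only \<open>t \<ge> 0\<close> is constrained.\<close>

locale markov_semigroup =
  fixes P :: "real \<Rightarrow> 'a::metric_space \<Rightarrow> 'a measure"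
  assumes kernel: "t \<ge> 0 \<Longrightarrow> P t \<in> borel \<rightarrow>\<^sub>M prob_algebra borel"
    and jointly_measurable: "A \<in> sets borel \<Longrightarrow>
      (\<lambda>(t, x). measure (P t x) A) \<in> borel_measurable (restrict_space borel {0..} \<Otimes>\<^sub>M borel)"
    and P_zero: "P 0 x = return borel x"
    and chapman_kolmogorov: "s \<ge> 0 \<Longrightarrow> t \<ge> 0 \<Longrightarrow> A \<in> sets borel \<Longrightarrow>
      emeasure (P (s + t) x) A = (\<integral>\<^sup>+ y. emeasure (P t y) A \<partial>(P s x))"

text \<open>For a stochastic kernel, \<open>emeasure_bind\<close> gives
  \<open>\<nu>P\<^sub>t(A) = \<integral> P\<^sub>t(x, A) \<nu>(dx)\<close>.\<close>

definition measure_act :: "'a::metric_space measure \<Rightarrow> (real \<Rightarrow> 'a \<Rightarrow> 'a measure) \<Rightarrow> real \<Rightarrow> 'a measure" where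
  "measure_act \<nu> P t = bind \<nu> (P t)"

definition fun_act :: "(real \<Rightarrow> 'a::metric_space \<Rightarrow> 'a measure) \<Rightarrow> real \<Rightarrow> ('a \<Rightarrow> real) \<Rightarrow> 'a \<Rightarrow> real" where
  "fun_act P t f x = (\<integral>y. f y \<partial>(P t x))"

definition invariant_measure :: "(real \<Rightarrow> 'a::metric_space \<Rightarrow> 'a measure) \<Rightarrow> 'a measure \<Rightarrow> bool" where
  "invariant_measure P \<nu> \<longleftrightarrow> \<nu> \<in> M1 \<and> (\<forall>t\<ge>0. measure_act \<nu> P t = \<nu>)"

text \<open>\<open>process_sigma \<Omega> \<Phi> I\<close> is \<open>\<sigma>(\<Phi>\<^sub>s : s \<in> I)\<close> on \<open>\<Omega>\<close>.\<close>

definition process_sigma :: "'w set \<Rightarrow> (real \<Rightarrow> 'w \<Rightarrow> 'a::metric_space) \<Rightarrow> real set \<Rightarrow> 'w measure" where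
  "process_sigma \<Omega> \<Phi> I = sigma \<Omega> {\<Phi> s -` A \<inter> \<Omega> | s A. s \<in> I \<and> A \<in> sets borel}"

locale markov_process = markov_semigroup P
  for P :: "real \<Rightarrow> 'a::metric_space \<Rightarrow> 'a measure" +
  fixes \<Omega> :: "'w set"
    and \<Phi> :: "real \<Rightarrow> 'w \<Rightarrow> 'a"
    and \<theta> :: "real \<Rightarrow> 'w \<Rightarrow> 'w"
    and Pr :: "'a \<Rightarrow> 'w measure"
  assumes shift_closed: "t \<ge> 0 \<Longrightarrow> \<theta> t \<in> \<Omega> \<rightarrow> \<Omega>"
    and shift: "s \<ge> 0 \<Longrightarrow> t \<ge> 0 \<Longrightarrow> \<omega> \<in> \<Omega> \<Longrightarrow> \<Phi> (s + t) \<omega> = \<Phi> s (\<theta> t \<omega>)"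
    and prob: "prob_space (Pr x)"
    and sets_Pr: "sets (Pr x) = sets (process_sigma \<Omega> \<Phi> {0..})"
    and start: "measure (Pr x) {\<omega> \<in> \<Omega>. \<Phi> 0 \<omega> = x} = 1"
    and markov: "s \<ge> 0 \<Longrightarrow> t \<ge> 0 \<Longrightarrow> A \<in> sets borel \<Longrightarrow>
      AE \<omega> in Pr x.
        real_cond_exp (Pr x) (process_sigma \<Omega> \<Phi> {0..s}) (indicator {\<omega> \<in> \<Omega>. \<Phi> (t + s) \<omega> \<in> A}) \<omega>
        = measure (Pr (\<Phi> s \<omega>)) {\<omega>' \<in> \<Omega>. \<Phi> t \<omega>' \<in> A}"
    and transition: "t \<ge> 0 \<Longrightarrow> A \<in> sets borel \<Longrightarrow>
      measure (Pr x) {\<omega> \<in> \<Omega>. \<Phi> t \<omega> \<in> A} = measure (P t x) A"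
    and progressive: "t \<ge> 0 \<Longrightarrow>
      (\<lambda>(s, \<omega>). \<Phi> s \<omega>) \<in> restrict_space borel {0..t} \<Otimes>\<^sub>M process_sigma \<Omega> \<Phi> {0..t} \<rightarrow>\<^sub>M borel"

definition stochastically_continuous :: "(real \<Rightarrow> 'a::metric_space \<Rightarrow> 'a measure) \<Rightarrow> bool" where
  "stochastically_continuous P \<longleftrightarrow>
    (\<forall>f\<in>BC. \<forall>x. ((\<lambda>t. fun_act P t f x) \<longlongrightarrow> f x) (at_right 0))"

definition feller :: "(real \<Rightarrow> 'a::metric_space \<Rightarrow> 'a measure) \<Rightarrow> bool" where
  "feller P \<longleftrightarrow> (\<forall>f\<in>BC. \<forall>t\<ge>0. fun_act P t f \<in> BC)"

definition wasserstein_contractive :: "(real \<Rightarrow> 'a::metric_space \<Rightarrow> 'a measure) \<Rightarrow> bool" where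
  "wasserstein_contractive P \<longleftrightarrow>
    (\<forall>\<nu>\<in>M1_moment 1. \<forall>t>0. measure_act \<nu> P t \<in> M1_moment 1) \<and>
    (\<exists>\<gamma>>0. \<forall>t\<ge>0. \<forall>x y.
      d_W (measure_act (return borel x) P t) (measure_act (return borel y) P t)
        \<le> ennreal (exp (- \<gamma> * t) * dist x y))"

definition moment_bounded :: "(real \<Rightarrow> 'a::metric_space \<Rightarrow> 'a measure) \<Rightarrow> 'a measure \<Rightarrow> bool" where
  "moment_bounded P \<mu> \<longleftrightarrow>
    (\<exists>x0. \<exists>\<zeta>>2. (SUP t\<in>{0..}. \<integral>\<^sup>+ y. ennreal (dist x0 y powr \<zeta>) \<partial>(measure_act \<mu> P t)) < \<infinity>)"

definition chi :: "(real \<Rightarrow> 'a::metric_space \<Rightarrow> 'a measure) \<Rightarrow> ('a \<Rightarrow> real) \<Rightarrow> 'a \<Rightarrow> real" where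
  "chi P g x = (LBINT t:{0..}. fun_act P t g x)"

text \<open>\<open>Z\<^sub>n(g)\<close>, intended for \<open>n \<ge> 1\<close>.\<close>

definition Z :: "(real \<Rightarrow> 'a::metric_space \<Rightarrow> 'a measure) \<Rightarrow> (real \<Rightarrow> 'w \<Rightarrow> 'a) \<Rightarrow> ('a \<Rightarrow> real) \<Rightarrow> nat \<Rightarrow> 'w \<Rightarrow> real" where
  "Z P \<Phi> g n \<omega> = chi P g (\<Phi> (real n) \<omega>) - chi P g (\<Phi> (real n - 1) \<omega>)
     + (LBINT s:{real n - 1..real n}. g (\<Phi> s \<omega>))"

definition trunc :: "real \<Rightarrow> enat \<Rightarrow> real" where
  "trunc a p = (case p of enat m \<Rightarrow> min a (real m) | \<infinity> \<Rightarrow> a)"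

definition avg_Z ::
  "(real \<Rightarrow> 'a::metric_space \<Rightarrow> 'a measure) \<Rightarrow> (real \<Rightarrow> 'w \<Rightarrow> 'a) \<Rightarrow> ('a \<Rightarrow> real) \<Rightarrow> enat \<Rightarrow> nat \<Rightarrow> nat \<Rightarrow> 'w \<Rightarrow> real" where
  "avg_Z P \<Phi> g p i n \<omega> = 1 / real n * (\<Sum>k=1..n. trunc ((Z P \<Phi> g (2 * k + i) \<omega>)\<^sup>2) p)"

text \<open>For \<open>p = \<infinity>\<close> the lower and upper limits may be infinite, so they are taken in \<open>ereal\<close>;
  the minimum with \<open>1\<close> is always finite, which makes \<open>real_of_ereal\<close> harmless.\<close>

definition I_fun ::
  "(real \<Rightarrow> 'a::metric_space \<Rightarrow> 'a measure) \<Rightarrow> (real \<Rightarrow> 'w \<Rightarrow> 'a) \<Rightarrow> ('a \<Rightarrow> 'w measure) \<Rightarrow>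
   ('a \<Rightarrow> real) \<Rightarrow> enat \<Rightarrow> real \<Rightarrow> nat \<Rightarrow> 'a \<Rightarrow> real" where
  "I_fun P \<Phi> Pr g p d i x =
    (\<integral>\<omega>. real_of_ereal (min \<bar>liminf (\<lambda>n. ereal (avg_Z P \<Phi> g p i n \<omega>)) - ereal d\<bar> 1) \<partial>(Pr x))"

definition S_fun ::
  "(real \<Rightarrow> 'a::metric_space \<Rightarrow> 'a measure) \<Rightarrow> (real \<Rightarrow> 'w \<Rightarrow> 'a) \<Rightarrow> ('a \<Rightarrow> 'w measure) \<Rightarrow>
   ('a \<Rightarrow> real) \<Rightarrow> enat \<Rightarrow> real \<Rightarrow> nat \<Rightarrow> 'a \<Rightarrow> real" where
  "S_fun P \<Phi> Pr g p d i x =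
    (\<integral>\<omega>. real_of_ereal (min \<bar>limsup (\<lambda>n. ereal (avg_Z P \<Phi> g p i n \<omega>)) - ereal d\<bar> 1) \<partial>(Pr x))"

end

theory Submission
  imports Defs
begin

text \<open>
  Both functions turn out to be constant, and continuity follows from that.  The limits of the
  averages do not depend on any initial part of the path, and the Wasserstein contraction makes the
  processes started at two points \<open>x\<close> and \<open>y\<close> approach each other exponentially fast.  A coupling
  \<open>(\<Phi>, \<Phi>')\<close> of the two processes with expected distance at most \<open>exp (- \<gamma> * t) * dist x y\<close> at time \<open>t\<close>
  would make \<open>\<Sum>\<^sub>n \<bar>Z\<^sub>n - Z'\<^sub>n\<bar>\<close> finite almost surely, and then the averages of the truncated squares
  would have equal lower and equal upper limits along both paths.

  The proof uses this idea in a dual form that needs no coupling.  Call a functional of the path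
  Lipschitz if it changes by at most \<open>\<Sum>t\<in>T. L t * dist (\<phi> t) (\<psi> t)\<close> for some finite set \<open>T\<close> of
  times.  Integrating out the last time of \<open>T\<close> by the Markov property moves its weight to the
  previous time, multiplied by the contraction factor of the elapsed time.  Repeating this down to
  time \<open>0\<close> shows that the expectations from \<open>x\<close> and \<open>y\<close> differ by at most
  \<open>(\<Sum>t\<in>T. L t * exp (- \<gamma> * t)) * dist x y\<close> (\<open>expectation_contraction\<close>).

  Each \<open>Z\<^sub>n\<close> is a limit of such functionals: \<open>\<chi>\<close> is Lipschitz because the contraction can be
  integrated over time (\<open>chi_lipschitz\<close>), and by stochastic continuity the integral of \<open>g\<close> along the
  path is a limit in mean of averages over finitely many times (\<open>window_sample_tendsto\<close>).  Since the
  discounted weights decay geometrically in \<open>n\<close>, a functional of \<open>Z\<^sub>1, \<dots>, Z\<^sub>N\<close> that is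
  \<open>\<epsilon>\<close>-Lipschitz for the sum of the coordinate differences has expectations that differ by at most
  \<open>\<epsilon> * D * dist x y\<close>, with \<open>D\<close> independent of \<open>N\<close> (\<open>functional_contraction\<close>).

  Finally, the square root of the average over \<open>k \<le> n\<close> is a Euclidean norm divided by \<open>sqrt n\<close>, so it
  is \<open>1 / sqrt n\<close>-Lipschitz for every truncation level, including \<open>\<infinity>\<close>.  The minimum and the maximum
  of the averages over a window \<open>{m..m + M}\<close> inherit the constant \<open>1 / sqrt m\<close>.  Letting \<open>M\<close> and then
  \<open>m\<close> tend to infinity produces the lower and upper limits, and the bound on the difference of the
  expectations tends to \<open>0\<close>.
\<close>

section \<open>Preliminaries on measurability and integration\<close>

text \<open>A functional of finitely many coordinates can be read as a continuous function on the
  sequence space \<open>nat \<Rightarrow> 'b\<close>, whose Borel sets are generated by the coordinates.  The detour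
  through \<open>nat\<close> makes the lemma applicable to functionals on paths, indexed by the real time axis:
  for uncountable index sets the Borel sets of the product exceed the product \<open>\<sigma>\<close>-algebra.\<close>

lemma borel_measurable_finite_lipschitz:
  fixes F :: "('i \<Rightarrow> 'b::{metric_space, second_countable_topology}) \<Rightarrow> real"
  assumes fin: "finite I"
    and lip: "\<And>u v. \<bar>F u - F v\<bar> \<le> (\<Sum>i\<in>I. L i * dist (u i) (v i))"
    and X: "\<And>i. i \<in> I \<Longrightarrow> X i \<in> borel_measurable M"
  shows "(\<lambda>w. F (\<lambda>i. X i w)) \<in> borel_measurable M"
proof (cases "I = {}")
  case True
  have "F u = F undefined" for u
    using lip[of u undefined] True by simp
  then have "(\<lambda>w. F (\<lambda>i. X i w)) = (\<lambda>w. F undefined)"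
    by auto
  then show ?thesis by simp
next
  case False
  define G where "G u = F (\<lambda>i. u (to_nat_on I i))" for u :: "nat \<Rightarrow> 'b"
  have "continuous_on UNIV G"
    unfolding continuous_on_eq_continuous_at[OF open_UNIV] isCont_def
  proof
    fix u0 :: "nat \<Rightarrow> 'b"
    have coord: "((\<lambda>u. u k) \<longlongrightarrow> u0 k) (at u0)" for k
    proof -
      have "continuous_on UNIV (\<lambda>u :: nat \<Rightarrow> 'b. u k)"
        by (rule continuous_on_product_coordinates)
      then show ?thesis
        by (simp add: continuous_on_def)
    qed
    have "((\<lambda>u. \<Sum>i\<in>I. L i * dist (u (to_nat_on I i)) (u0 (to_nat_on I i))) \<longlongrightarrow>
        (\<Sum>i\<in>I. L i * dist (u0 (to_nat_on I i)) (u0 (to_nat_on I i)))) (at u0)"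
      by (intro tendsto_sum tendsto_mult tendsto_dist tendsto_const coord)
    then have "((\<lambda>u. \<Sum>i\<in>I. L i * dist (u (to_nat_on I i)) (u0 (to_nat_on I i))) \<longlongrightarrow> 0) (at u0)"
      by simp
    then have "((\<lambda>u. G u - G u0) \<longlongrightarrow> 0) (at u0)"
      by (rule Lim_null_comparison[rotated]) (auto simp: G_def lip)
    then show "(G \<longlongrightarrow> G u0) (at u0)"
      by (rule LIM_zero_cancel)
  qed
  then have "G \<in> borel_measurable (PiM UNIV (\<lambda>_. borel))"
    using borel_measurable_continuous_onI measurable_cong_sets[OF sets_PiM_equal_borel refl] by blast
  moreover have "(\<lambda>w n. X (from_nat_into I n) w) \<in> M \<rightarrow>\<^sub>M PiM UNIV (\<lambda>_. borel)"
    using False by (intro measurable_PiM_single') (auto intro: X from_nat_into)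
  ultimately have "(\<lambda>w. G (\<lambda>n. X (from_nat_into I n) w)) \<in> borel_measurable M"
    by (rule measurable_compose[rotated])
  moreover have "G (\<lambda>n. X (from_nat_into I n) w) = F (\<lambda>i. X i w)" for w
  proof -
    have "\<bar>G (\<lambda>n. X (from_nat_into I n) w) - F (\<lambda>i. X i w)\<bar> \<le> (\<Sum>i\<in>I. 0)"
      unfolding G_def
      by (rule order_trans[OF lip]) (auto intro!: sum_mono simp: countable_finite[OF fin])
    then show ?thesis by simp
  qed
  ultimately show ?thesis by simp
qed

lemma abs_integral_le:
  fixes f g :: "'b \<Rightarrow> real"
  assumes "integrable M f" "integrable M g" "\<And>x. x \<in> space M \<Longrightarrow> \<bar>f x\<bar> \<le> g x"
  shows "\<bar>integral\<^sup>L M f\<bar> \<le> integral\<^sup>L M g"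
  using assms by (intro order_trans[OF integral_abs_bound] Bochner_Integration.integral_mono) auto

lemma (in prob_space) abs_integral_le_const:
  fixes f :: "'a \<Rightarrow> real"
  assumes "f \<in> borel_measurable M" "\<And>x. x \<in> space M \<Longrightarrow> \<bar>f x\<bar> \<le> C"
  shows "integrable M f" "\<bar>integral\<^sup>L M f\<bar> \<le> C"
proof -
  show *: "integrable M f"
    using assms by (intro integrable_const_bound[where B=C]) auto
  show "\<bar>integral\<^sup>L M f\<bar> \<le> C"
    using abs_integral_le[OF *, of "\<lambda>_. C"] assms by (simp add: prob_space)
qed

lemma integral_bind_bounded:
  fixes f :: "'b \<Rightarrow> real"
  assumes M: "prob_space M" and N [measurable]: "N \<in> M \<rightarrow>\<^sub>M subprob_algebra B"
    and f [measurable]: "f \<in> borel_measurable B" and bound: "\<And>x. \<bar>f x\<bar> \<le> C"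
  shows "integral\<^sup>L (M \<bind> N) f = (\<integral>x. integral\<^sup>L (N x) f \<partial>M)"
proof -
  interpret M: prob_space M by (rule M)
  have sp: "subprob_space (N x)" "sets (N x) = sets B" if "x \<in> space M" for x
    using subprob_space_kernel[OF N that] sets_kernel[OF N that] by auto
  have sets_bind' [measurable_cong]: "sets (M \<bind> N) = sets B"
    using M.not_empty by (intro sets_bind[OF sets_kernel[OF N]]) auto
  have fin: "finite_measure (M \<bind> N)"
    using subprob_space_bind[OF prob_space_imp_subprob_space[OF M] N] by (simp add: subprob_space_def)
  have intg: "integrable (N x) h" if "x \<in> space M" "h \<in> borel_measurable B" "\<And>y. \<bar>h y\<bar> \<le> C"
    for x and h :: "'b \<Rightarrow> real"
    using sp[OF that(1)] that(2,3) measurable_cong_sets[OF sp(2)[OF that(1)] refl]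
    by (intro finite_measure.integrable_const_bound[where B=C]) (auto simp: subprob_space_def)
  have intM: "integrable M (\<lambda>x. integral\<^sup>L (N x) h)"
    if h: "h \<in> borel_measurable B" "\<And>y. \<bar>h y\<bar> \<le> C" for h :: "'b \<Rightarrow> real"
  proof (rule M.integrable_const_bound[where B=C])
    show "(\<lambda>x. integral\<^sup>L (N x) h) \<in> borel_measurable M"
      using measurable_compose[OF N integral_measurable_subprob_algebra[OF h(1)]] .
    show "AE x in M. norm (integral\<^sup>L (N x) h) \<le> C"
    proof (rule AE_I2)
      fix x assume x: "x \<in> space M"
      interpret subprob_space "N x" by (rule sp[OF x])
      have "norm (integral\<^sup>L (N x) h) \<le> (\<integral>y. C \<partial>N x)"
        unfolding real_norm_def using h(2) by (intro abs_integral_le[OF intg[OF x h]]) auto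
      also have "\<dots> \<le> 1 * C"
        unfolding lebesgue_integral_const scaleR_conv_of_real of_real_eq_id id_apply
        using h(2)[of undefined] by (intro mult_right_mono subprob_measure_le_1) auto
      finally show "norm (integral\<^sup>L (N x) h) \<le> C" by simp
    qed
  qed
  have nonneg: "integral\<^sup>L (M \<bind> N) h = (\<integral>x. integral\<^sup>L (N x) h \<partial>M)"
    if h [measurable]: "h \<in> borel_measurable B" and h_le: "\<And>y. \<bar>h y\<bar> \<le> C" and h_ge: "\<And>y. 0 \<le> h y"
    for h :: "'b \<Rightarrow> real"
  proof -
    have "integral\<^sup>L (M \<bind> N) h = enn2real (\<integral>\<^sup>+x. (\<integral>\<^sup>+y. ennreal (h y) \<partial>N x) \<partial>M)"
      using h_ge by (subst integral_eq_nn_integral) (auto simp: nn_integral_bind[OF _ N])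
    also have "(\<integral>\<^sup>+x. (\<integral>\<^sup>+y. ennreal (h y) \<partial>N x) \<partial>M) = (\<integral>\<^sup>+x. ennreal (integral\<^sup>L (N x) h) \<partial>M)"
      using h_ge by (intro nn_integral_cong nn_integral_eq_integral intg[OF _ h h_le]) auto
    also have "enn2real \<dots> = (\<integral>x. integral\<^sup>L (N x) h \<partial>M)"
      using h_ge intM[OF h h_le] by (intro integral_eq_nn_integral[symmetric]) auto
    finally show ?thesis .
  qed
  define p n where "p y = max 0 (f y)" and "n y = max 0 (- f y)" for y
  have [measurable]: "p \<in> borel_measurable B" "n \<in> borel_measurable B"
    unfolding p_def n_def by auto
  have le: "\<bar>p y\<bar> \<le> C" "\<bar>n y\<bar> \<le> C" "0 \<le> p y" "0 \<le> n y" for y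
    using bound[of y] by (auto simp: p_def n_def)
  have f_eq: "f = (\<lambda>y. p y - n y)" by (auto simp: p_def n_def max_def)
  have "integrable (M \<bind> N) p" "integrable (M \<bind> N) n"
    using le by (auto intro!: finite_measure.integrable_const_bound[OF fin, where B=C])
  then have "integral\<^sup>L (M \<bind> N) f = (\<integral>x. integral\<^sup>L (N x) p \<partial>M) - (\<integral>x. integral\<^sup>L (N x) n \<partial>M)"
    unfolding f_eq using le by (simp add: nonneg)
  also have "\<dots> = (\<integral>x. integral\<^sup>L (N x) p - integral\<^sup>L (N x) n \<partial>M)"
    using le by (intro Bochner_Integration.integral_diff[symmetric] intM) auto
  also have "\<dots> = (\<integral>x. integral\<^sup>L (N x) f \<partial>M)"
    unfolding f_eq using le
    by (intro Bochner_Integration.integral_cong refl Bochner_Integration.integral_diff[symmetric] intg) auto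
  finally show ?thesis .
qed

context markov_semigroup
begin

lemma prob_space_transition: "0 \<le> t \<Longrightarrow> prob_space (P t x)"
  and sets_transition: "0 \<le> t \<Longrightarrow> sets (P t x) = sets borel"
  using measurable_space[OF kernel, of t x] by (auto simp: space_prob_algebra)

lemma space_transition: "0 \<le> t \<Longrightarrow> space (P t x) = UNIV"
  using sets_eq_imp_space_eq[OF sets_transition] by simp

lemma measurable_transition:
  "0 \<le> t \<Longrightarrow> f \<in> borel \<rightarrow>\<^sub>M N \<Longrightarrow> f \<in> P t x \<rightarrow>\<^sub>M N"
  by (subst measurable_cong_sets[OF sets_transition refl])

lemma kernel_subprob: "0 \<le> t \<Longrightarrow> P t \<in> borel \<rightarrow>\<^sub>M subprob_algebra borel"
  using kernel by (rule measurable_prob_algebraD)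

text \<open>Joint measurability in time and space makes \<open>t \<mapsto> P\<^sub>t g(x)\<close> measurable, which the integral
  over time that defines \<open>\<chi>\<close> needs.\<close>

lemma kernel_time_measurable:
  "(\<lambda>t. P t x) \<in> restrict_space borel {0..} \<rightarrow>\<^sub>M subprob_algebra borel"
proof (rule measurable_subprob_algebra)
  fix t assume "t \<in> space (restrict_space borel {0::real..})"
  then have t: "0 \<le> t" by (simp add: space_restrict_space)
  show "subprob_space (P t x)"
    using prob_space_transition[OF t] by (rule prob_space_imp_subprob_space)
  show "sets (P t x) = sets borel" by (rule sets_transition[OF t])
next
  fix A :: "'a set" assume A: "A \<in> sets borel"
  have "(\<lambda>t. measure (P t x) A) \<in> borel_measurable (restrict_space borel {0..})"
    using measurable_compose[OF measurable_Pair2'[of x borel "restrict_space borel {0..}"]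
        jointly_measurable[OF A]] by simp
  then have "(\<lambda>t. ennreal (measure (P t x) A)) \<in> borel_measurable (restrict_space borel {0..})"
    by simp
  then show "(\<lambda>t. emeasure (P t x) A) \<in> borel_measurable (restrict_space borel {0..})"
    by (rule measurable_cong[THEN iffD2, rotated])
       (simp add: space_restrict_space finite_measure.emeasure_eq_measure prob_space.finite_measure
         prob_space_transition)
qed

end

section \<open>The Markov property for functionals of the past and one later position\<close>

lemma process_sigma_generator: "{\<Phi> s -` A \<inter> \<Omega> | s A. s \<in> I \<and> A \<in> sets borel} \<subseteq> Pow \<Omega>"
  by auto

lemma space_process_sigma [simp]: "space (process_sigma \<Omega> \<Phi> I) = \<Omega>"
  unfolding process_sigma_def by (rule space_measure_of[OF process_sigma_generator])

lemma sets_process_sigma: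
  "sets (process_sigma \<Omega> \<Phi> I) = sigma_sets \<Omega> {\<Phi> s -` A \<inter> \<Omega> | s A. s \<in> I \<and> A \<in> sets borel}"
  unfolding process_sigma_def by (rule sets_measure_of[OF process_sigma_generator])

lemma sets_process_sigma_mono:
  "I \<subseteq> J \<Longrightarrow> sets (process_sigma \<Omega> \<Phi> I) \<subseteq> sets (process_sigma \<Omega> \<Phi> J)"
  unfolding sets_process_sigma by (rule sigma_sets_mono') auto

lemma measurable_process_sigma:
  "t \<in> I \<Longrightarrow> \<Phi> t \<in> borel_measurable (process_sigma \<Omega> \<Phi> I)"
  by (rule measurableI) (auto simp: sets_process_sigma intro!: sigma_sets.Basic)

context markov_process
begin

sublocale Pr: prob_space "Pr x" for x
  by (rule prob)

lemma space_Pr [simp]: "space (Pr x) = \<Omega>"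
  using sets_eq_imp_space_eq[OF sets_Pr] by simp

lemma measurable_Pr [measurable]: "0 \<le> t \<Longrightarrow> \<Phi> t \<in> borel_measurable (Pr x)"
  using measurable_process_sigma[of t "{0..}" \<Phi> \<Omega>] measurable_cong_sets[OF sets_Pr refl] by auto

lemma subalgebra_past: "0 \<le> s \<Longrightarrow> subalgebra (Pr x) (process_sigma \<Omega> \<Phi> {0..s})"
  unfolding subalgebra_def using sets_process_sigma_mono[of "{0..s}" "{0..}" \<Omega> \<Phi>]
  by (auto simp: sets_Pr)

lemma AE_start: "AE \<omega> in Pr x. \<Phi> 0 \<omega> = x"
proof -
  have "{\<omega> \<in> \<Omega>. \<Phi> 0 \<omega> = x} \<in> sets (Pr x)"
    using start[of x] measure_notin_sets by fastforce
  then show ?thesis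
    using Pr.prob_Collect_eq_1[of x "\<lambda>\<omega>. \<Phi> 0 \<omega> = x"] start[of x] by simp
qed

text \<open>The Markov property is given through conditional expectations; integrating it over an event of
  the past turns it into an identity between measures of rectangles.\<close>

lemma markov_rectangle:
  assumes s: "0 \<le> s" and h: "0 \<le> h"
    and B: "B \<in> sets (process_sigma \<Omega> \<Phi> {0..s})" and A: "A \<in> sets borel"
  shows "measure (Pr x) (B \<inter> {\<omega> \<in> \<Omega>. \<Phi> (s + h) \<omega> \<in> A}) =
    (\<integral>\<omega>. indicator B \<omega> * measure (P h (\<Phi> s \<omega>)) A \<partial>Pr x)"
proof -
  let ?F = "process_sigma \<Omega> \<Phi> {0..s}"
  let ?E = "{\<omega> \<in> \<Omega>. \<Phi> (h + s) \<omega> \<in> A}"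
  interpret sub: finite_measure_subalgebra "Pr x" ?F
    by (intro finite_measure_subalgebra.intro finite_measure_subalgebra_axioms.intro subalgebra_past s)
       unfold_locales
  have E: "?E \<in> sets (Pr x)"
    using measurable_sets[OF measurable_Pr[of "h + s" x] A] s h
    by (simp add: vimage_def Int_def conj_commute)
  have B': "B \<in> sets (Pr x)"
    using B subalgebra_past[OF s, of x] by (auto simp: subalgebra_def)
  have "measure (Pr x) (B \<inter> ?E) = (\<integral>\<omega>\<in>B. indicator ?E \<omega> \<partial>Pr x)"
    using B' E sets.sets_into_space[OF B']
    by (simp add: set_lebesgue_integral_def Int_absorb2 le_infI1 flip: indicator_inter_arith)
  also have "\<dots> = (\<integral>\<omega>\<in>B. real_cond_exp (Pr x) ?F (indicator ?E) \<omega> \<partial>Pr x)"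
    by (rule sub.real_cond_exp_intA[OF _ B]) (use E in \<open>simp add: Pr.emeasure_eq_measure\<close>)
  also have "\<dots> = (\<integral>\<omega>. indicator B \<omega> * measure (P h (\<Phi> s \<omega>)) A \<partial>Pr x)"
    unfolding set_lebesgue_integral_def
  proof (rule integral_cong_AE)
    show "(\<lambda>\<omega>. indicator B \<omega> *\<^sub>R real_cond_exp (Pr x) ?F (indicator ?E) \<omega>) \<in> borel_measurable (Pr x)"
      using B' by measurable
    have "(\<lambda>y. measure (P h y) A) \<in> borel_measurable borel"
      using measurable_compose[OF kernel_subprob[OF h] measurable_measure_subprob_algebra[OF A]] .
    from measurable_compose[OF measurable_Pr[OF s] this]
    show "(\<lambda>\<omega>. indicator B \<omega> * measure (P h (\<Phi> s \<omega>)) A) \<in> borel_measurable (Pr x)"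
      using B' by measurable
    show "AE \<omega> in Pr x. indicator B \<omega> *\<^sub>R real_cond_exp (Pr x) ?F (indicator ?E) \<omega> =
        indicator B \<omega> * measure (P h (\<Phi> s \<omega>)) A"
      using markov[OF s h A, of x] by eventually_elim (simp add: transition[OF h A])
  qed
  finally show ?thesis by (simp add: add.commute)
qed

text \<open>Rectangles generate the product \<open>\<sigma>\<close>-algebra, so the joint law of the past and a later position
  is the law of the past followed by the transition kernel.\<close>

lemma markov_integral:
  fixes H :: "'w \<times> 'a \<Rightarrow> real"
  assumes s: "0 \<le> s" and h: "0 \<le> h"
    and H [measurable]: "H \<in> borel_measurable (process_sigma \<Omega> \<Phi> {0..s} \<Otimes>\<^sub>M borel)"
    and bound: "\<And>z. \<bar>H z\<bar> \<le> B"
  shows "(\<integral>\<omega>. H (\<omega>, \<Phi> (s + h) \<omega>) \<partial>Pr x) = (\<integral>\<omega>. (\<integral>y. H (\<omega>, y) \<partial>P h (\<Phi> s \<omega>)) \<partial>Pr x)"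
proof -
  define F where "F = process_sigma \<Omega> \<Phi> {0..s}"
  have spF [simp]: "space F = \<Omega>" by (simp add: F_def)
  have H [measurable]: "H \<in> borel_measurable (F \<Otimes>\<^sub>M borel)"
    using H by (simp add: F_def)
  have id [measurable]: "(\<lambda>\<omega>. \<omega>) \<in> Pr x \<rightarrow>\<^sub>M F"
    using subalgebra_past[OF s, of x] sets.sets_into_space[of _ F]
    by (intro measurableI) (auto simp: F_def subalgebra_def Int_absorb2)
  have [measurable]: "\<Phi> s \<in> borel_measurable F" "\<Phi> (s + h) \<in> borel_measurable (Pr x)"
    using s h measurable_process_sigma[of s "{0..s}"] by (auto simp: F_def)
  have [measurable]: "P h \<in> borel \<rightarrow>\<^sub>M subprob_algebra borel" by (rule kernel_subprob[OF h])
  define K where "K \<omega> = distr (P h (\<Phi> s \<omega>)) (F \<Otimes>\<^sub>M borel) (\<lambda>y. (\<omega>, y))" for \<omega>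
  have K [measurable]: "K \<in> F \<rightarrow>\<^sub>M subprob_algebra (F \<Otimes>\<^sub>M borel)"
    unfolding K_def by (rule measurable_distr2[where M=borel]) measurable
  have K_Pr [measurable]: "K \<in> Pr x \<rightarrow>\<^sub>M subprob_algebra (F \<Otimes>\<^sub>M borel)"
    using measurable_compose[OF id K] .
  \<comment> \<open>The two candidates for the joint law of the past and the position at time \<open>s + h\<close>.\<close>
  define N1 where "N1 = distr (Pr x) (F \<Otimes>\<^sub>M borel) (\<lambda>\<omega>. (\<omega>, \<Phi> (s + h) \<omega>))"
  define N2 where "N2 = Pr x \<bind> K"
  have sets_N2: "sets N2 = sets (F \<Otimes>\<^sub>M borel)"
    unfolding N2_def using Pr.not_empty by (intro sets_bind[OF sets_kernel[OF K_Pr]]) auto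
  have emeasure_eq: "emeasure N1 (B \<times> A) = emeasure N2 (B \<times> A)"
    if B [measurable]: "B \<in> sets F" and A [measurable]: "A \<in> sets borel" for B A
  proof -
    have B' [measurable]: "B \<in> sets (Pr x)"
      using B subalgebra_past[OF s, of x] by (auto simp: F_def subalgebra_def)
    have "emeasure N1 (B \<times> A) = emeasure (Pr x) (B \<inter> {\<omega> \<in> \<Omega>. \<Phi> (s + h) \<omega> \<in> A})"
      unfolding N1_def using sets.sets_into_space[OF B]
      by (subst emeasure_distr) (auto intro!: arg_cong2[where f=emeasure])
    also have "\<dots> = ennreal (\<integral>\<omega>. indicator B \<omega> * measure (P h (\<Phi> s \<omega>)) A \<partial>Pr x)"
      using markov_rectangle[OF s h B[unfolded F_def] A] by (simp add: Pr.emeasure_eq_measure)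
    also have "\<dots> = (\<integral>\<^sup>+\<omega>. ennreal (indicator B \<omega> * measure (P h (\<Phi> s \<omega>)) A) \<partial>Pr x)"
    proof (rule nn_integral_eq_integral[symmetric])
      have "(\<lambda>\<omega>. measure (P h (\<Phi> s \<omega>)) A) \<in> borel_measurable (Pr x)"
        using s by measurable
      then show "integrable (Pr x) (\<lambda>\<omega>. indicator B \<omega> * measure (P h (\<Phi> s \<omega>)) A)"
        by (intro Pr.integrable_const_bound[where B=1])
           (auto simp: indicator_def prob_space.prob_le_1 prob_space_transition[OF h])
    qed auto
    also have "\<dots> = (\<integral>\<^sup>+\<omega>. emeasure (K \<omega>) (B \<times> A) \<partial>Pr x)"
    proof (rule nn_integral_cong)
      fix \<omega> assume "\<omega> \<in> space (Pr x)"
      then have [measurable]: "(\<lambda>y. (\<omega>, y)) \<in> P h (\<Phi> s \<omega>) \<rightarrow>\<^sub>M F \<Otimes>\<^sub>M borel"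
        by (auto simp: measurable_cong_sets[OF sets_transition[OF h] refl] intro!: measurable_Pair1')
      have "(\<lambda>y. (\<omega>, y)) -` (B \<times> A) = (if \<omega> \<in> B then A else {})"
        by auto
      then show "ennreal (indicator B \<omega> * measure (P h (\<Phi> s \<omega>)) A) = emeasure (K \<omega>) (B \<times> A)"
        unfolding K_def
        by (subst emeasure_distr)
           (auto simp: space_transition[OF h] finite_measure.emeasure_eq_measure[OF prob_space.finite_measure[OF prob_space_transition[OF h]]])
    qed
    also have "\<dots> = emeasure N2 (B \<times> A)"
      unfolding N2_def using Pr.not_empty by (intro emeasure_bind[OF _ K_Pr, symmetric]) auto
    finally show ?thesis .
  qed
  have "N1 = N2"
  proof (rule measure_eqI_generator_eq[OF Int_stable_pair_measure_generator pair_measure_closed])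
    show "emeasure N1 X = emeasure N2 X" if "X \<in> {a \<times> b |a b. a \<in> sets F \<and> b \<in> sets (borel :: 'a measure)}" for X
      using that emeasure_eq by auto
    show "sets N1 = sigma_sets (space F \<times> space borel) {a \<times> b |a b. a \<in> sets F \<and> b \<in> sets (borel :: 'a measure)}"
      by (simp add: N1_def sets_pair_measure)
    show "sets N2 = sigma_sets (space F \<times> space borel) {a \<times> b |a b. a \<in> sets F \<and> b \<in> sets (borel :: 'a measure)}"
      by (simp add: sets_N2 sets_pair_measure)
    show "range (\<lambda>_::nat. space F \<times> UNIV) \<subseteq> {a \<times> b |a b. a \<in> sets F \<and> b \<in> sets (borel :: 'a measure)}"
      using sets.top[of F] sets.top[of "borel :: 'a measure"]
      by (intro image_subsetI CollectI exI[of _ "space F"] exI[of _ UNIV] conjI) auto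
    interpret N1: prob_space N1 unfolding N1_def by (rule Pr.prob_space_distr) auto
    show "emeasure N1 (space F \<times> UNIV) \<noteq> \<infinity>" by simp
  qed auto
  have "(\<integral>\<omega>. H (\<omega>, \<Phi> (s + h) \<omega>) \<partial>Pr x) = integral\<^sup>L N1 H"
    unfolding N1_def by (rule integral_distr[symmetric]) auto
  also have "\<dots> = (\<integral>\<omega>. integral\<^sup>L (K \<omega>) H \<partial>Pr x)"
    unfolding \<open>N1 = N2\<close> N2_def
    using bound by (intro integral_bind_bounded[OF Pr.prob_space_axioms K_Pr]) auto
  also have "\<dots> = (\<integral>\<omega>. (\<integral>y. H (\<omega>, y) \<partial>P h (\<Phi> s \<omega>)) \<partial>Pr x)"
  proof (rule Bochner_Integration.integral_cong[OF refl])
    fix \<omega> assume "\<omega> \<in> space (Pr x)"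
    then have "(\<lambda>y. (\<omega>, y)) \<in> P h (\<Phi> s \<omega>) \<rightarrow>\<^sub>M F \<Otimes>\<^sub>M borel"
      by (auto simp: measurable_cong_sets[OF sets_transition[OF h] refl] intro!: measurable_Pair1')
    then show "integral\<^sup>L (K \<omega>) H = (\<integral>y. H (\<omega>, y) \<partial>P h (\<Phi> s \<omega>))"
      unfolding K_def by (intro integral_distr) auto
  qed
  finally show ?thesis .
qed

end

section \<open>Discounted Lipschitz constants of path functionals\<close>

text \<open>The number \<open>r\<close> bounds the sum of the coordinate Lipschitz constants, each discounted by the
  contraction factor of its time.  By \<open>expectation_contraction\<close> below it is a Lipschitz constant of
  the expected value as a function of the starting point.\<close>

definition path_lipschitz :: "real \<Rightarrow> ((real \<Rightarrow> 'a::metric_space) \<Rightarrow> real) \<Rightarrow> real \<Rightarrow> bool" where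
  "path_lipschitz \<gamma> F r \<longleftrightarrow> (\<exists>T L. finite T \<and> T \<subseteq> {0..} \<and> (\<forall>t\<in>T. 0 \<le> L t) \<and>
    (\<forall>\<phi> \<psi>. \<bar>F \<phi> - F \<psi>\<bar> \<le> (\<Sum>t\<in>T. L t * dist (\<phi> t) (\<psi> t))) \<and>
    (\<Sum>t\<in>T. L t * exp (- \<gamma> * t)) \<le> r)"

lemma path_lipschitz_eval:
  assumes t: "0 \<le> t" and L: "0 \<le> L" and f: "\<And>x y. \<bar>f x - f y\<bar> \<le> L * dist x y"
  shows "path_lipschitz \<gamma> (\<lambda>\<phi>. f (\<phi> t)) (L * exp (- \<gamma> * t))"
  unfolding path_lipschitz_def
  by (rule exI[of _ "{t}"], rule exI[of _ "\<lambda>_. L"]) (use t L f in simp)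

text \<open>The chain rule for discounted constants: each intermediate functional \<open>\<zeta> n\<close> may use its own
  finite set of times, and the weights are collected on the union of these sets.\<close>

lemma path_lipschitz_combine:
  assumes J: "finite J" and w: "\<And>n. n \<in> J \<Longrightarrow> 0 \<le> w n"
    and \<zeta>: "\<And>n. n \<in> J \<Longrightarrow> path_lipschitz \<gamma> (\<zeta> n) (r n)"
    and F: "\<And>\<phi> \<psi>. \<bar>F \<phi> - F \<psi>\<bar> \<le> (\<Sum>n\<in>J. w n * \<bar>\<zeta> n \<phi> - \<zeta> n \<psi>\<bar>)"
  shows "path_lipschitz \<gamma> F (\<Sum>n\<in>J. w n * r n)"
proof -
  define is_modulus where "is_modulus n S \<longleftrightarrow> finite (fst S) \<and> fst S \<subseteq> {0..} \<and> (\<forall>t\<in>fst S. 0 \<le> snd S t) \<and>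
    (\<forall>\<phi> \<psi>. \<bar>\<zeta> n \<phi> - \<zeta> n \<psi>\<bar> \<le> (\<Sum>t\<in>fst S. snd S t * dist (\<phi> t) (\<psi> t))) \<and>
    (\<Sum>t\<in>fst S. snd S t * exp (- \<gamma> * t)) \<le> r n" for n and S :: "real set \<times> (real \<Rightarrow> real)"
  have "\<exists>S. is_modulus n S" if "n \<in> J" for n
    using \<zeta>[OF that] unfolding path_lipschitz_def is_modulus_def by simp
  then obtain S where S: "\<And>n. n \<in> J \<Longrightarrow> is_modulus n (S n)"
    by metis
  define T where "T n = fst (S n)" for n
  define L where "L n = snd (S n)" for n
  have fin: "finite (T n)" and T0: "T n \<subseteq> {0..}" and L0: "t \<in> T n \<Longrightarrow> 0 \<le> L n t"
    and lip: "\<bar>\<zeta> n \<phi> - \<zeta> n \<psi>\<bar> \<le> (\<Sum>t\<in>T n. L n t * dist (\<phi> t) (\<psi> t))"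
    and r: "(\<Sum>t\<in>T n. L n t * exp (- \<gamma> * t)) \<le> r n" if "n \<in> J" for n t \<phi> \<psi>
    using S[OF that] unfolding is_modulus_def T_def L_def by auto
  define T' where "T' = (\<Union>n\<in>J. T n)"
  define L' where "L' t = (\<Sum>n\<in>J. w n * (if t \<in> T n then L n t else 0))" for t
  have fin': "finite T'" using J fin by (auto simp: T'_def)
  have swap: "(\<Sum>t\<in>T'. L' t * c t) = (\<Sum>n\<in>J. w n * (\<Sum>t\<in>T n. L n t * c t))" for c
  proof -
    have "(\<Sum>t\<in>T'. L' t * c t) = (\<Sum>t\<in>T'. \<Sum>n\<in>J. w n * ((if t \<in> T n then L n t else 0) * c t))"
      unfolding L'_def by (simp add: sum_distrib_right mult.assoc)
    also have "\<dots> = (\<Sum>n\<in>J. w n * (\<Sum>t\<in>T'. (if t \<in> T n then L n t else 0) * c t))"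
      by (subst sum.swap) (simp only: sum_distrib_left)
    also have "\<dots> = (\<Sum>n\<in>J. w n * (\<Sum>t\<in>T n. L n t * c t))"
    proof (rule sum.cong[OF refl])
      fix n assume "n \<in> J"
      then have "(\<Sum>t\<in>T'. (if t \<in> T n then L n t else 0) * c t) = (\<Sum>t\<in>T n. L n t * c t)"
        by (intro sum.mono_neutral_cong_right fin') (auto simp: T'_def)
      then show "w n * (\<Sum>t\<in>T'. (if t \<in> T n then L n t else 0) * c t) = w n * (\<Sum>t\<in>T n. L n t * c t)"
        by simp
    qed
    finally show ?thesis .
  qed
  show ?thesis
    unfolding path_lipschitz_def
  proof (intro exI[of _ T'] exI[of _ L'] conjI ballI allI)
    show "finite T'" by (rule fin')
    show "T' \<subseteq> {0..}" using T0 by (auto simp: T'_def)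
    show "0 \<le> L' t" for t unfolding L'_def using w L0 by (auto intro!: sum_nonneg)
    show "\<bar>F \<phi> - F \<psi>\<bar> \<le> (\<Sum>t\<in>T'. L' t * dist (\<phi> t) (\<psi> t))" for \<phi> \<psi>
      unfolding swap by (rule order_trans[OF F]) (intro sum_mono mult_left_mono lip w)
    show "(\<Sum>t\<in>T'. L' t * exp (- \<gamma> * t)) \<le> (\<Sum>n\<in>J. w n * r n)"
      unfolding swap by (intro sum_mono mult_left_mono r w)
  qed
qed

section \<open>Contraction of expectations of path functionals\<close>

locale contracting_markov_process = markov_process P \<Omega> \<Phi> \<theta> Pr
  for P :: "real \<Rightarrow> 'a::{metric_space, second_countable_topology} \<Rightarrow> 'a measure"
    and \<Omega> :: "'w set" and \<Phi> \<theta> Pr +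
  fixes \<gamma> :: real
  assumes rate_pos: "0 < \<gamma>"
    and contraction: "\<lbrakk>0 \<le> t; 0 \<le> L; \<And>x y. \<bar>f x - f y\<bar> \<le> L * dist x y\<rbrakk> \<Longrightarrow>
      \<bar>(\<integral>z. f z \<partial>P t x) - (\<integral>z. f z \<partial>P t y)\<bar> \<le> L * exp (- \<gamma> * t) * dist x y"
begin

lemma measurable_path_functional:
  assumes "finite T" "T \<subseteq> {0..}"
    and "\<And>\<phi> \<psi>. \<bar>F \<phi> - F \<psi>\<bar> \<le> (\<Sum>t\<in>T. L t * dist (\<phi> t) (\<psi> t))"
  shows "(\<lambda>\<omega>. F (\<lambda>t. \<Phi> t \<omega>)) \<in> borel_measurable (Pr x)"
  by (rule borel_measurable_finite_lipschitz[OF assms(1,3)]) (use assms(2) in \<open>auto intro: measurable_Pr\<close>)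

text \<open>Induction on the set of times, removing the latest time \<open>b\<close>.  If \<open>s\<close> is the time before it,
  conditioning on the past up to \<open>s\<close> replaces \<open>F\<close> by the average \<open>F'\<close> of \<open>F\<close> over the position at \<open>b\<close>.
  The kernel contraction turns the constant \<open>L b\<close> into an extra \<open>L b * exp (- \<gamma> * (b - s))\<close> at \<open>s\<close>, which
  leaves the discounted sum unchanged.  Time \<open>0\<close> always belongs to the set, so that the previous time
  exists; at time \<open>0\<close> the position is the starting point.\<close>

lemma expectation_contraction_finite:
  fixes F :: "(real \<Rightarrow> 'a) \<Rightarrow> real"
  assumes "finite T" "T \<subseteq> {0<..}"
    and "\<And>t. t \<in> insert 0 T \<Longrightarrow> 0 \<le> L t"
    and "\<And>\<phi> \<psi>. \<bar>F \<phi> - F \<psi>\<bar> \<le> (\<Sum>t\<in>insert 0 T. L t * dist (\<phi> t) (\<psi> t))"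
    and "\<And>\<phi>. \<bar>F \<phi>\<bar> \<le> B"
  shows "\<bar>(\<integral>\<omega>. F (\<lambda>t. \<Phi> t \<omega>) \<partial>Pr x) - (\<integral>\<omega>. F (\<lambda>t. \<Phi> t \<omega>) \<partial>Pr y)\<bar> \<le>
    (\<Sum>t\<in>insert 0 T. L t * exp (- \<gamma> * t)) * dist x y"
  using assms
proof (induction T arbitrary: L F rule: finite_linorder_max_induct)
  case empty
  have "(\<integral>\<omega>. F (\<lambda>t. \<Phi> t \<omega>) \<partial>Pr z) = F (\<lambda>_. z)" for z
  proof -
    have "(\<integral>\<omega>. F (\<lambda>t. \<Phi> t \<omega>) \<partial>Pr z) = (\<integral>\<omega>. F (\<lambda>_. z) \<partial>Pr z)"
    proof (rule integral_cong_AE)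
      show "(\<lambda>\<omega>. F (\<lambda>t. \<Phi> t \<omega>)) \<in> borel_measurable (Pr z)"
        by (rule measurable_path_functional[OF _ _ empty(3)]) auto
      show "AE \<omega> in Pr z. F (\<lambda>t. \<Phi> t \<omega>) = F (\<lambda>_. z)"
        using AE_start
      proof eventually_elim
        case (elim \<omega>)
        then show ?case using empty(3)[of "\<lambda>t. \<Phi> t \<omega>" "\<lambda>_. z"] by simp
      qed
    qed auto
    then show ?thesis using Pr.prob_space[of z] by simp
  qed
  then show ?case using empty(3)[of "\<lambda>_. x" "\<lambda>_. y"] by simp
next
  case (insert b T)
  define s where "s = Max (insert 0 T)"
  have s_in: "s \<in> insert 0 T" unfolding s_def using insert.hyps by (intro Max_in) auto
  have T_le: "t \<le> s" if "t \<in> insert 0 T" for t unfolding s_def using insert.hyps that by (intro Max_ge) auto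
  have s0: "0 \<le> s" using T_le by simp
  have b: "0 < b" "b \<notin> insert 0 T" using insert.prems(1) insert.hyps by auto
  have sb: "s < b" using s_in insert.hyps b by auto
  define h where "h = b - s"
  have h: "0 \<le> h" "s + h = b" using sb by (auto simp: h_def)
  have set_eq: "insert 0 (insert b T) = insert b (insert 0 T)" by auto
  have fin: "finite (insert 0 T)" using insert.hyps by simp
  have L0: "0 \<le> L t" if "t \<in> insert b (insert 0 T)" for t using insert.prems(2) that by (auto simp: insert_commute)
  have lip: "\<bar>F \<phi> - F \<psi>\<bar> \<le> L b * dist (\<phi> b) (\<psi> b) + (\<Sum>t\<in>insert 0 T. L t * dist (\<phi> t) (\<psi> t))" for \<phi> \<psi>
    using insert.prems(3)[of \<phi> \<psi>] unfolding set_eq sum.insert[OF fin b(2)] .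
  define F' where "F' \<phi> = (\<integral>y. F (\<phi>(b := y)) \<partial>P h (\<phi> s))" for \<phi>
  define L' where "L' = L(s := L s + L b * exp (- \<gamma> * h))"
  have sum_L': "(\<Sum>t\<in>insert 0 T. L' t * c t) = (\<Sum>t\<in>insert 0 T. L t * c t) + L b * exp (- \<gamma> * h) * c s" for c
  proof -
    have "(\<Sum>t\<in>insert 0 T. L' t * c t) = (\<Sum>t\<in>insert 0 T. L t * c t + (if t = s then L b * exp (- \<gamma> * h) * c s else 0))"
      by (intro sum.cong refl) (auto simp: L'_def algebra_simps)
    then show ?thesis using fin s_in by (simp only: sum.distrib sum.delta if_True)
  qed
  have slice_lip: "\<bar>F (\<phi>(b := y)) - F (\<phi>(b := y'))\<bar> \<le> L b * dist y y'" for \<phi> y y'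
  proof -
    have "(\<Sum>t\<in>insert 0 T. L t * dist ((\<phi>(b := y)) t) ((\<phi>(b := y')) t)) = 0"
      using b(2) by (intro sum.neutral) auto
    then show ?thesis using lip[of "\<phi>(b := y)" "\<phi>(b := y')"] by simp
  qed
  have slice_meas: "(\<lambda>y. F (\<phi>(b := y))) \<in> borel_measurable borel" for \<phi>
  proof -
    have "(\<lambda>y. F (\<lambda>t. if t = b then y else \<phi> t)) \<in> borel_measurable borel"
      by (rule borel_measurable_finite_lipschitz[OF _ insert.prems(3)]) (use insert.hyps in auto)
    then show ?thesis by (simp add: fun_upd_def)
  qed
  have slice_int: "integrable (P h z) (\<lambda>y. F (\<phi>(b := y)))" for z \<phi>
    by (rule prob_space.abs_integral_le_const(1)[OF prob_space_transition[OF h(1)]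
          measurable_transition[OF h(1) slice_meas] insert.prems(4)])
  have F'_lip: "\<bar>F' \<phi> - F' \<psi>\<bar> \<le> (\<Sum>t\<in>insert 0 T. L' t * dist (\<phi> t) (\<psi> t))" for \<phi> \<psi>
  proof -
    interpret Q: prob_space "P h (\<psi> s)" by (rule prob_space_transition[OF h(1)])
    have 1: "\<bar>F' \<phi> - (\<integral>y. F (\<phi>(b := y)) \<partial>P h (\<psi> s))\<bar> \<le> L b * exp (- \<gamma> * h) * dist (\<phi> s) (\<psi> s)"
      unfolding F'_def by (rule contraction[OF h(1) _ slice_lip]) (use L0 in auto)
    have "\<bar>(\<integral>y. F (\<phi>(b := y)) - F (\<psi>(b := y)) \<partial>P h (\<psi> s))\<bar> \<le>
        (\<integral>y. (\<Sum>t\<in>insert 0 T. L t * dist (\<phi> t) (\<psi> t)) \<partial>P h (\<psi> s))"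
    proof (rule abs_integral_le)
      fix y
      have "(\<Sum>t\<in>insert 0 T. L t * dist ((\<phi>(b := y)) t) ((\<psi>(b := y)) t)) = (\<Sum>t\<in>insert 0 T. L t * dist (\<phi> t) (\<psi> t))"
        using b(2) by (intro sum.cong) auto
      then show "\<bar>F (\<phi>(b := y)) - F (\<psi>(b := y))\<bar> \<le> (\<Sum>t\<in>insert 0 T. L t * dist (\<phi> t) (\<psi> t))"
        using lip[of "\<phi>(b := y)" "\<psi>(b := y)"] by simp
    qed (auto intro: slice_int)
    then have 2: "\<bar>(\<integral>y. F (\<phi>(b := y)) \<partial>P h (\<psi> s)) - F' \<psi>\<bar> \<le> (\<Sum>t\<in>insert 0 T. L t * dist (\<phi> t) (\<psi> t))"
      unfolding F'_def using slice_int by (simp del: sum.insert add: Q.prob_space)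
    show ?thesis unfolding sum_L' using 1 2 by linarith
  qed
  have F'_le: "\<bar>F' \<phi>\<bar> \<le> B" for \<phi>
  proof -
    interpret Q: prob_space "P h (\<phi> s)" by (rule prob_space_transition[OF h(1)])
    show ?thesis
      unfolding F'_def by (rule Q.abs_integral_le_const(2)[OF measurable_transition[OF h(1) slice_meas] insert.prems(4)])
  qed
  have reduce: "(\<integral>\<omega>. F (\<lambda>t. \<Phi> t \<omega>) \<partial>Pr z) = (\<integral>\<omega>. F' (\<lambda>t. \<Phi> t \<omega>) \<partial>Pr z)" for z
  proof -
    define H where "H = (\<lambda>(\<omega>, y). F ((\<lambda>t. \<Phi> t \<omega>)(b := y)))"
    have "(\<lambda>u. F (\<lambda>t. (if t = b then snd u else \<Phi> t (fst u)))) \<in>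
        borel_measurable (process_sigma \<Omega> \<Phi> {0..s} \<Otimes>\<^sub>M borel)"
    proof (rule borel_measurable_finite_lipschitz[OF _ insert.prems(3)])
      show "finite (insert 0 (insert b T))" using insert.hyps by simp
      fix t assume t: "t \<in> insert 0 (insert b T)"
      show "(\<lambda>u. if t = b then snd u else \<Phi> t (fst u)) \<in> borel_measurable (process_sigma \<Omega> \<Phi> {0..s} \<Otimes>\<^sub>M borel)"
      proof (cases "t = b")
        case False
        with t have "t \<in> {0..s}" using T_le[of t] insert.prems(1) by force
        from measurable_compose[OF measurable_fst measurable_process_sigma[OF this]] False
        show ?thesis by simp
      qed simp
    qed
    then have "H \<in> borel_measurable (process_sigma \<Omega> \<Phi> {0..s} \<Otimes>\<^sub>M borel)"
      by (simp add: H_def fun_upd_def case_prod_beta)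
    from markov_integral[OF s0 h(1) this, of B z]
    have "(\<integral>\<omega>. H (\<omega>, \<Phi> b \<omega>) \<partial>Pr z) = (\<integral>\<omega>. (\<integral>y. H (\<omega>, y) \<partial>P h (\<Phi> s \<omega>)) \<partial>Pr z)"
      using insert.prems(4) by (simp add: H_def h(2) case_prod_beta)
    moreover have "(\<lambda>t. \<Phi> t \<omega>)(b := \<Phi> b \<omega>) = (\<lambda>t. \<Phi> t \<omega>)" for \<omega>
      by auto
    ultimately show ?thesis by (simp add: H_def F'_def)
  qed
  have "\<bar>(\<integral>\<omega>. F' (\<lambda>t. \<Phi> t \<omega>) \<partial>Pr x) - (\<integral>\<omega>. F' (\<lambda>t. \<Phi> t \<omega>) \<partial>Pr y)\<bar> \<le>
      (\<Sum>t\<in>insert 0 T. L' t * exp (- \<gamma> * t)) * dist x y"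
    by (rule insert.IH[OF _ _ F'_lip F'_le]) (use insert.prems(1) L0 s_in in \<open>auto simp: L'_def\<close>)
  also have "(\<Sum>t\<in>insert 0 T. L' t * exp (- \<gamma> * t)) = (\<Sum>t\<in>insert 0 (insert b T). L t * exp (- \<gamma> * t))"
  proof -
    have "exp (- \<gamma> * h) * exp (- \<gamma> * s) = exp (- \<gamma> * b)"
      by (simp add: h(2)[symmetric] exp_add[symmetric] algebra_simps)
    then show ?thesis unfolding sum_L' set_eq sum.insert[OF fin b(2)] by simp
  qed
  finally show ?case unfolding reduce .
qed

lemma expectation_contraction:
  assumes F: "path_lipschitz \<gamma> F r" and bound: "\<And>\<phi>. \<bar>F \<phi>\<bar> \<le> B"
  shows "\<bar>(\<integral>\<omega>. F (\<lambda>t. \<Phi> t \<omega>) \<partial>Pr x) - (\<integral>\<omega>. F (\<lambda>t. \<Phi> t \<omega>) \<partial>Pr y)\<bar> \<le> r * dist x y"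
proof -
  obtain T L where T: "finite T" "T \<subseteq> {0..}" and L: "\<And>t. t \<in> T \<Longrightarrow> 0 \<le> L t"
    and lip: "\<And>\<phi> \<psi>. \<bar>F \<phi> - F \<psi>\<bar> \<le> (\<Sum>t\<in>T. L t * dist (\<phi> t) (\<psi> t))"
    and r: "(\<Sum>t\<in>T. L t * exp (- \<gamma> * t)) \<le> r"
    using F unfolding path_lipschitz_def by blast
  define L' where "L' t = (if t \<in> T then L t else 0)" for t
  have ins: "(\<Sum>t\<in>insert 0 (T - {0}). L' t * c t) = (\<Sum>t\<in>T. L t * c t)" for c
    using T by (intro sum.mono_neutral_cong_right) (auto simp: L'_def)
  have "\<bar>(\<integral>\<omega>. F (\<lambda>t. \<Phi> t \<omega>) \<partial>Pr x) - (\<integral>\<omega>. F (\<lambda>t. \<Phi> t \<omega>) \<partial>Pr y)\<bar> \<le>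
      (\<Sum>t\<in>insert 0 (T - {0}). L' t * exp (- \<gamma> * t)) * dist x y"
  proof (rule expectation_contraction_finite[OF _ _ _ _ bound])
    show "\<bar>F \<phi> - F \<psi>\<bar> \<le> (\<Sum>t\<in>insert 0 (T - {0}). L' t * dist (\<phi> t) (\<psi> t))" for \<phi> \<psi>
      unfolding ins by (rule lip)
  qed (use T L in \<open>auto simp: L'_def\<close>)
  also have "\<dots> \<le> r * dist x y"
    unfolding ins by (intro mult_right_mono r) simp
  finally show ?thesis .
qed

end

section \<open>Sampling the unit time windows\<close>

definition window :: "nat \<Rightarrow> real measure" where
  "window n = restrict_space lborel {real n - 1..real n}"

text \<open>Sampling points lie to the right of \<open>s\<close>, so that stochastic continuity applies to the increment
  from \<open>s\<close> to the sampling point.  The mesh \<open>1 / Suc k\<close> avoids a division by zero.\<close>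

definition next_grid :: "nat \<Rightarrow> real \<Rightarrow> real" where
  "next_grid k s = real_of_int \<lceil>s * real (Suc k)\<rceil> / real (Suc k)"

lemma space_window [simp]: "space (window n) = {real n - 1..real n}"
  by (simp add: window_def space_restrict_space)

lemma prob_space_window: "prob_space (window n)"
proof
  show "emeasure (window n) (space (window n)) = 1"
    by (simp add: window_def emeasure_restrict_space space_restrict_space)
qed

lemma measurable_window: "f \<in> borel_measurable borel \<Longrightarrow> f \<in> borel_measurable (window n)"
  unfolding window_def by (rule measurable_restrict_space1) simp

lemma integral_window: "(LBINT s:{real n - 1..real n}. f s) = (\<integral>s. f s \<partial>window n)"
  for f :: "real \<Rightarrow> real"
  unfolding window_def set_lebesgue_integral_def by (rule integral_restrict_space[symmetric]) simp

lemma next_grid_measurable [measurable]: "next_grid k \<in> borel_measurable borel"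
  unfolding next_grid_def by measurable

lemma next_grid_bounds: "s \<le> next_grid k s" "next_grid k s \<le> s + 1 / real (Suc k)"
proof -
  define K where "K = real (Suc k)"
  have K: "0 < K" by (simp add: K_def)
  have "s = s * K / K" using K by simp
  also have "\<dots> \<le> real_of_int \<lceil>s * K\<rceil> / K"
    using K by (intro divide_right_mono) auto
  finally show "s \<le> next_grid k s" by (simp add: next_grid_def K_def)
  have "real_of_int \<lceil>s * K\<rceil> / K \<le> (s * K + 1) / K"
    using K of_int_ceiling_le_add_one[of "s * K"] by (intro divide_right_mono) auto
  also have "\<dots> = s + 1 / K" using K by (simp add: field_simps)
  finally show "next_grid k s \<le> s + 1 / real (Suc k)" by (simp add: next_grid_def K_def)
qed

text \<open>Integers are grid points of every mesh, so sampling never leaves a window.\<close>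

lemma next_grid_le:
  assumes "s \<le> real n" shows "next_grid k s \<le> real n"
proof -
  have "s * real (Suc k) \<le> real n * real (Suc k)"
    using assms by (intro mult_right_mono) auto
  also have "\<dots> = real_of_int (int (n * Suc k))" by (simp add: algebra_simps)
  finally have "\<lceil>s * real (Suc k)\<rceil> \<le> int (n * Suc k)" by (simp only: ceiling_le_iff)
  then have "real_of_int \<lceil>s * real (Suc k)\<rceil> \<le> real n * real (Suc k)"
    by (metis of_int_le_iff of_int_of_nat_eq of_nat_mult)
  then show ?thesis
    unfolding next_grid_def by (simp add: divide_le_eq del: of_nat_Suc)
qed

lemma next_grid_tendsto: "(\<lambda>k. next_grid k s - s) \<longlonglongrightarrow> 0"
proof (rule tendsto_sandwich[OF _ _ tendsto_const LIMSEQ_inverse_real_of_nat])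
  show "\<forall>\<^sub>F k in sequentially. 0 \<le> next_grid k s - s"
    using next_grid_bounds(1) by simp
  show "\<forall>\<^sub>F k in sequentially. next_grid k s - s \<le> inverse (real (Suc k))"
    using next_grid_bounds(2)[of _ s] by (simp add: inverse_eq_divide algebra_simps del: of_nat_Suc)
qed

lemma simple_function_next_grid: "simple_function (window n) (next_grid k)"
proof (rule simple_function_borel_measurable)
  show "next_grid k \<in> borel_measurable (window n)"
    by (rule measurable_window) measurable
  have "next_grid k ` space (window n) \<subseteq> (\<lambda>j. real_of_int j / real (Suc k)) `
      {\<lceil>(real n - 1) * real (Suc k)\<rceil>..\<lceil>real n * real (Suc k)\<rceil>}"
    unfolding next_grid_def
    by (auto simp del: of_nat_Suc intro!: imageI ceiling_mono mult_right_mono)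
  then show "finite (next_grid k ` space (window n))"
    by (rule finite_subset) simp
qed

text \<open>The sampled time takes finitely many values, so integrating over it is a finite weighted sum
  over sampling times.  The weights are the measures of its level sets.\<close>

lemma integral_next_grid:
  fixes c :: "real \<Rightarrow> real"
  shows "integrable (window n) (\<lambda>s. c (next_grid k s))"
    and "(\<integral>s. c (next_grid k s) \<partial>window n) = (\<Sum>v\<in>next_grid k ` space (window n).
      measure (window n) (next_grid k -` {v} \<inter> space (window n)) * c v)"
proof -
  interpret prob_space "window n" by (rule prob_space_window)
  let ?R = "next_grid k ` space (window n)"
  let ?A = "\<lambda>v. next_grid k -` {v} \<inter> space (window n)"
  have fin: "finite ?R" using simple_function_next_grid by (rule simple_functionD(1))
  have A: "?A v \<in> sets (window n)" for v
    using simple_function_next_grid by (rule simple_functionD(2))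
  have eq: "c (next_grid k s) = (\<Sum>v\<in>?R. indicator (?A v) s * c v)" if "s \<in> space (window n)" for s
  proof -
    have "(\<Sum>v\<in>?R. indicator (?A v) s * c v) = (\<Sum>v\<in>?R. if v = next_grid k s then c v else 0)"
      using that by (intro sum.cong) (auto simp: indicator_def)
    also have "\<dots> = c (next_grid k s)"
      using that fin by (simp add: sum.delta)
    finally show ?thesis by simp
  qed
  have int: "integrable (window n) (\<lambda>s. indicator (?A v) s * c v)" for v
    using A by (intro integrable_mult_left integrable_real_indicator) (auto simp: emeasure_eq_measure)
  show "integrable (window n) (\<lambda>s. c (next_grid k s))"
    using int by (subst Bochner_Integration.integrable_cong[OF refl eq]) auto
  have "(\<integral>s. c (next_grid k s) \<partial>window n) = (\<Sum>v\<in>?R. \<integral>s. indicator (?A v) s * c v \<partial>window n)"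
    using int by (subst Bochner_Integration.integral_cong[OF refl eq]) auto
  also have "\<dots> = (\<Sum>v\<in>?R. measure (window n) (?A v) * c v)"
    using A by (intro sum.cong refl) (simp add: Int_absorb2)
  finally show "(\<integral>s. c (next_grid k s) \<partial>window n) = (\<Sum>v\<in>?R. measure (window n) (?A v) * c v)" .
qed

lemma path_lipschitz_mono: "path_lipschitz \<gamma> F r \<Longrightarrow> r \<le> r' \<Longrightarrow> path_lipschitz \<gamma> F r'"
  unfolding path_lipschitz_def by (meson order_trans)

lemma path_lipschitz_plus:
  assumes "path_lipschitz \<gamma> F r" "path_lipschitz \<gamma> G s"
    and "\<And>\<phi> \<psi>. \<bar>H \<phi> - H \<psi>\<bar> \<le> \<bar>F \<phi> - F \<psi>\<bar> + \<bar>G \<phi> - G \<psi>\<bar>"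
  shows "path_lipschitz \<gamma> H (r + s)"
proof -
  have "path_lipschitz \<gamma> H (\<Sum>b\<in>UNIV. 1 * (if b then r else s))"
    by (rule path_lipschitz_combine[where \<zeta> = "\<lambda>b. if b then F else G"])
       (use assms in \<open>auto simp: UNIV_bool add.commute\<close>)
  then show ?thesis by (simp add: UNIV_bool add.commute)
qed

text \<open>The weights of the sampling times add up to \<open>1\<close> and every sampling time is at least
  \<open>n - 1\<close>, which bounds the discounted constant uniformly in the mesh.\<close>

lemma path_lipschitz_window_sample:
  assumes n: "1 \<le> n" and L: "0 \<le> L" and f: "\<And>x y. \<bar>f x - f y\<bar> \<le> L * dist x y" and \<gamma>: "0 \<le> \<gamma>"
  shows "path_lipschitz \<gamma> (\<lambda>\<phi>. \<integral>s. f (\<phi> (next_grid k s)) \<partial>window n) (L * exp (- \<gamma> * (real n - 1)))"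
proof -
  interpret prob_space "window n" by (rule prob_space_window)
  let ?R = "next_grid k ` space (window n)"
  let ?w = "\<lambda>v. measure (window n) (next_grid k -` {v} \<inter> space (window n))"
  have R: "real n - 1 \<le> v" if "v \<in> ?R" for v
    using that next_grid_bounds(1)[of _ k] by (auto intro: order_trans)
  have "path_lipschitz \<gamma> (\<lambda>\<phi>. \<integral>s. f (\<phi> (next_grid k s)) \<partial>window n)
      (\<Sum>v\<in>?R. ?w v * (L * exp (- \<gamma> * v)))"
  proof (rule path_lipschitz_combine)
    show "finite ?R" using simple_function_next_grid by (rule simple_functionD(1))
    show "path_lipschitz \<gamma> (\<lambda>\<phi>. f (\<phi> v)) (L * exp (- \<gamma> * v))" if "v \<in> ?R" for v
      using R[OF that] n by (intro path_lipschitz_eval L f) simp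
    fix \<phi> \<psi> :: "real \<Rightarrow> 'a"
    have "(\<integral>s. f (\<phi> (next_grid k s)) \<partial>window n) - (\<integral>s. f (\<psi> (next_grid k s)) \<partial>window n) =
        (\<Sum>v\<in>?R. ?w v * (f (\<phi> v) - f (\<psi> v)))"
      unfolding integral_next_grid(2)[of n "\<lambda>v. f (\<phi> v)" k] integral_next_grid(2)[of n "\<lambda>v. f (\<psi> v)" k]
      by (simp add: sum_subtractf right_diff_distrib)
    then show "\<bar>(\<integral>s. f (\<phi> (next_grid k s)) \<partial>window n) - (\<integral>s. f (\<psi> (next_grid k s)) \<partial>window n)\<bar> \<le>
        (\<Sum>v\<in>?R. ?w v * \<bar>f (\<phi> v) - f (\<psi> v)\<bar>)"
      by (simp add: order_trans[OF sum_abs] abs_mult)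
  qed auto
  moreover have "(\<Sum>v\<in>?R. ?w v * (L * exp (- \<gamma> * v))) \<le> L * exp (- \<gamma> * (real n - 1))"
  proof -
    have "(\<Sum>v\<in>?R. ?w v * (L * exp (- \<gamma> * v))) = (\<integral>s. L * exp (- \<gamma> * next_grid k s) \<partial>window n)"
      by (rule integral_next_grid(2)[symmetric])
    also have "\<dots> \<le> (\<integral>s. L * exp (- \<gamma> * (real n - 1)) \<partial>window n)"
    proof (rule Bochner_Integration.integral_mono)
      show "integrable (window n) (\<lambda>s. L * exp (- \<gamma> * next_grid k s))"
        by (rule integral_next_grid(1))
      show "L * exp (- \<gamma> * next_grid k s) \<le> L * exp (- \<gamma> * (real n - 1))" if "s \<in> space (window n)" for s
        using R[of "next_grid k s"] that \<gamma> L by (intro mult_left_mono) (auto intro: mult_left_mono)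
    qed simp
    finally show ?thesis using prob_space by simp
  qed
  ultimately show ?thesis by (rule path_lipschitz_mono)
qed

section \<open>The corrector and the window integrals\<close>

locale observed_process = contracting_markov_process P \<Omega> \<Phi> \<theta> Pr \<gamma>
  for P :: "real \<Rightarrow> 'a::{metric_space, second_countable_topology} \<Rightarrow> 'a measure"
    and \<Omega> :: "'w set" and \<Phi> \<theta> Pr \<gamma> +
  fixes g :: "'a \<Rightarrow> real" and L C :: real
  assumes continuous_at_0: "stochastically_continuous P"
    and L_nonneg: "0 \<le> L" and g_lipschitz: "\<bar>g x - g y\<bar> \<le> L * dist x y"
    and g_bounded: "\<bar>g x\<bar> \<le> C"
begin

lemma g_continuous: "continuous_on UNIV g"
proof -
  have "L-lipschitz_on UNIV g"
    using L_nonneg g_lipschitz by (auto simp: lipschitz_on_def dist_real_def)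
  then show ?thesis by (rule lipschitz_on_continuous_on)
qed

lemma g_measurable [measurable]: "g \<in> borel_measurable borel"
  by (rule borel_measurable_continuous_onI[OF g_continuous])

lemma fun_act_contraction: "0 \<le> t \<Longrightarrow> \<bar>fun_act P t g x - fun_act P t g y\<bar> \<le> L * exp (- \<gamma> * t) * dist x y"
  unfolding fun_act_def by (rule contraction) (use L_nonneg g_lipschitz in auto)

text \<open>The contraction bounds \<open>\<bar>P\<^sub>t g(x) - P\<^sub>t g(y)\<bar>\<close> by \<open>L * exp (- \<gamma> * t) * dist x y\<close>, whose integral over
  time is \<open>L / \<gamma> * dist x y\<close>.  The difference is therefore integrable over time, so \<open>t \<mapsto> P\<^sub>t g(x)\<close> and
  \<open>t \<mapsto> P\<^sub>t g(y)\<close> are either both integrable or both not; in the second case both integrals have the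
  default value \<open>0\<close>.\<close>

lemma chi_lipschitz: "\<bar>chi P g x - chi P g y\<bar> \<le> L / \<gamma> * dist x y"
proof -
  define f where "f x t = indicator {0..} t *\<^sub>R fun_act P t g x" for x t
  have chi: "chi P g x = integral\<^sup>L lborel (f x)" for x
    unfolding chi_def set_lebesgue_integral_def f_def ..
  have f_meas [measurable]: "f x \<in> borel_measurable borel" for x
  proof -
    have "(\<lambda>t. fun_act P t g x) \<in> borel_measurable (restrict_space borel {0..})"
      unfolding fun_act_def
      using measurable_compose[OF kernel_time_measurable integral_measurable_subprob_algebra[OF g_measurable]] .
    then show ?thesis
      unfolding f_def by (subst (asm) borel_measurable_restrict_space_iff) auto
  qed
  let ?e = "\<lambda>t. L / \<gamma> * dist x y * exponential_density \<gamma> t"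
  interpret E: prob_space "density lborel (exponential_density \<gamma>)"
    by (rule prob_space_exponential_density[OF rate_pos])
  have e_nonneg: "0 \<le> exponential_density \<gamma> t" for t
    by (rule exponential_density_nonneg[OF rate_pos])
  have "(\<integral>\<^sup>+t. ennreal (exponential_density \<gamma> t) \<partial>lborel) = 1"
    using E.emeasure_space_1 by (simp add: emeasure_density)
  then have "has_bochner_integral lborel (exponential_density \<gamma>) 1"
    using e_nonneg by (intro has_bochner_integral_nn_integral) auto
  then have e: "integrable lborel ?e" "integral\<^sup>L lborel ?e = L / \<gamma> * dist x y"
    by (auto simp: has_bochner_integral_iff)
  have dom: "\<bar>f x t - f y t\<bar> \<le> ?e t" for t
    using fun_act_contraction[of t x y] rate_pos
    by (auto simp: f_def exponential_density_def indicator_def field_simps)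
  have diff: "integrable lborel (\<lambda>t. f x t - f y t)"
  proof (rule Bochner_Integration.integrable_bound[OF e(1)])
    show "AE t in lborel. norm (f x t - f y t) \<le> norm (?e t)"
      unfolding real_norm_def by (intro AE_I2 order_trans[OF dom abs_ge_self])
  qed auto
  show ?thesis
  proof (cases "integrable lborel (f y)")
    case True
    then have "integrable lborel (f x)"
      using Bochner_Integration.integrable_add[OF diff True] by simp
    with True have "chi P g x - chi P g y = (\<integral>t. f x t - f y t \<partial>lborel)"
      unfolding chi by simp
    then show ?thesis
      using abs_integral_le[OF diff e(1) dom] unfolding e(2) by simp
  next
    case False
    then have "\<not> integrable lborel (f x)"
      using Bochner_Integration.integrable_diff[OF _ diff, of "f x"] by auto
    with False show ?thesis
      unfolding chi using L_nonneg rate_pos by (simp add: not_integrable_integral_eq)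
  qed
qed

lemma chi_measurable [measurable]: "chi P g \<in> borel_measurable borel"
proof -
  have "(L / \<gamma>)-lipschitz_on UNIV (chi P g)"
    using L_nonneg rate_pos chi_lipschitz by (auto simp: lipschitz_on_def dist_real_def)
  then show ?thesis
    by (intro borel_measurable_continuous_onI lipschitz_on_continuous_on)
qed

text \<open>Clamping the time to \<open>[0, T]\<close> extends the progressively measurable path to a jointly
  measurable map on the whole real line, which is convenient for Fubini.\<close>

lemma clamped_path_measurable:
  assumes T: "0 \<le> T"
  shows "(\<lambda>(s, \<omega>). \<Phi> (max 0 (min T s)) \<omega>) \<in> borel_measurable (borel \<Otimes>\<^sub>M Pr x)"
proof -
  have "(\<lambda>s::real. max 0 (min T s)) \<in> borel \<rightarrow>\<^sub>M restrict_space borel {0..T}"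
    using T by (intro measurable_restrict_space2) auto
  moreover have "(\<lambda>\<omega>. \<omega>) \<in> Pr x \<rightarrow>\<^sub>M process_sigma \<Omega> \<Phi> {0..T}"
    using subalgebra_past[OF T, of x] sets.sets_into_space[of _ "process_sigma \<Omega> \<Phi> {0..T}"]
    by (intro measurableI) (auto simp: subalgebra_def Int_absorb2)
  ultimately have "(\<lambda>z. (max 0 (min T (fst z)), snd z)) \<in>
      borel \<Otimes>\<^sub>M Pr x \<rightarrow>\<^sub>M restrict_space borel {0..T} \<Otimes>\<^sub>M process_sigma \<Omega> \<Phi> {0..T}"
    by (intro measurable_Pair) (auto intro: measurable_compose[OF measurable_fst] measurable_compose[OF measurable_snd])
  from measurable_compose[OF this progressive[OF T]] show ?thesis
    by (simp add: case_prod_beta)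
qed

lemma path_integral_measurable:
  assumes n: "1 \<le> n" and \<tau>: "\<tau> \<in> borel_measurable borel" "\<And>s. s \<in> space (window n) \<Longrightarrow> \<tau> s \<in> space (window n)"
  shows "(\<lambda>(s, \<omega>). g (\<Phi> (max 0 (min (real n) (\<tau> s))) \<omega>)) \<in> borel_measurable (window n \<Otimes>\<^sub>M Pr x)"
    and "(\<lambda>\<omega>. \<integral>s. g (\<Phi> (\<tau> s) \<omega>) \<partial>window n) \<in> borel_measurable (Pr x)"
proof -
  interpret W: prob_space "window n" by (rule prob_space_window)
  have "(\<lambda>z. (\<tau> (fst z), snd z)) \<in> window n \<Otimes>\<^sub>M Pr x \<rightarrow>\<^sub>M borel \<Otimes>\<^sub>M Pr x"
    using measurable_window[OF \<tau>(1)] by (intro measurable_Pair) (auto intro: measurable_compose[OF measurable_fst])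
  from measurable_compose[OF measurable_compose[OF this clamped_path_measurable[of "real n" x]] g_measurable]
  show joint: "(\<lambda>(s, \<omega>). g (\<Phi> (max 0 (min (real n) (\<tau> s))) \<omega>)) \<in> borel_measurable (window n \<Otimes>\<^sub>M Pr x)"
    by (simp add: case_prod_beta)
  then have "(\<lambda>(\<omega>, s). g (\<Phi> (max 0 (min (real n) (\<tau> s))) \<omega>)) \<in> borel_measurable (Pr x \<Otimes>\<^sub>M window n)"
    by (subst measurable_pair_swap_iff) (simp add: case_prod_beta)
  from W.borel_measurable_lebesgue_integral[OF this]
  have "(\<lambda>\<omega>. \<integral>s. g (\<Phi> (max 0 (min (real n) (\<tau> s))) \<omega>) \<partial>window n) \<in> borel_measurable (Pr x)" .
  moreover have "max 0 (min (real n) (\<tau> s)) = \<tau> s" if "s \<in> space (window n)" for s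
    using \<tau>(2)[OF that] n by auto
  then have "(\<integral>s. g (\<Phi> (max 0 (min (real n) (\<tau> s))) \<omega>) \<partial>window n) =
      (\<integral>s. g (\<Phi> (\<tau> s) \<omega>) \<partial>window n)" for \<omega>
    by (intro Bochner_Integration.integral_cong) auto
  ultimately show "(\<lambda>\<omega>. \<integral>s. g (\<Phi> (\<tau> s) \<omega>) \<partial>window n) \<in> borel_measurable (Pr x)"
    by simp
qed

text \<open>By the Markov property the expected increment is the average, over the position at time \<open>s\<close>, of
  \<open>P\<^sub>h \<bar>g - g(z)\<bar>(z)\<close>.  This tends to \<open>0\<close> for each \<open>z\<close> because \<open>\<bar>g - g(z)\<bar>\<close> is a bounded continuous
  function that vanishes at \<open>z\<close>.\<close>

lemma increment_tendsto:
  assumes s: "0 \<le> s" and h: "\<And>k. 0 \<le> h k" and lim: "h \<longlonglongrightarrow> 0"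
  shows "(\<lambda>k. \<integral>\<omega>. \<bar>g (\<Phi> (s + h k) \<omega>) - g (\<Phi> s \<omega>)\<bar> \<partial>Pr x) \<longlonglongrightarrow> 0"
proof -
  define D where "D k z = (\<integral>y. \<bar>g y - g z\<bar> \<partial>P (h k) z)" for k z
  have bound: "\<bar>\<bar>g y - g z\<bar>\<bar> \<le> 2 * C" for y z
    using g_bounded[of y] g_bounded[of z] by linarith
  have D_le: "\<bar>D k z\<bar> \<le> 2 * C" for k z
    unfolding D_def
    by (rule prob_space.abs_integral_le_const(2)[OF prob_space_transition[OF h] measurable_transition[OF h] bound]) measurable
  have D_meas: "D k \<in> borel_measurable borel" for k
  proof -
    have "(\<lambda>z. distr (P (h k) z) (borel \<Otimes>\<^sub>M borel) (\<lambda>y. (z, y))) \<in> borel \<rightarrow>\<^sub>M subprob_algebra (borel \<Otimes>\<^sub>M borel)"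
      by (rule measurable_distr2[where M=borel, OF _ kernel_subprob[OF h]]) measurable
    from measurable_compose[OF this integral_measurable_subprob_algebra[of "\<lambda>(z, y). \<bar>g y - g z\<bar>"]]
    have "(\<lambda>z. integral\<^sup>L (distr (P (h k) z) (borel \<Otimes>\<^sub>M borel) (\<lambda>y. (z, y))) (\<lambda>(z, y). \<bar>g y - g z\<bar>)) \<in> borel_measurable borel"
      by simp
    moreover have "integral\<^sup>L (distr (P (h k) z) (borel \<Otimes>\<^sub>M borel) (\<lambda>y. (z, y))) (\<lambda>(z, y). \<bar>g y - g z\<bar>) = D k z" for z
      unfolding D_def
      by (subst integral_distr[OF measurable_transition[OF h measurable_Pair1']]) auto
    ultimately show ?thesis by simp
  qed
  have D_lim: "(\<lambda>k. D k z) \<longlonglongrightarrow> 0" for z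
  proof (rule tendstoI)
    fix e :: real assume e: "0 < e"
    let ?f = "\<lambda>y. \<bar>g y - g z\<bar>"
    have f: "?f \<in> BC"
      unfolding BC_def using bound
      by (auto intro!: continuous_intros g_continuous boundedI[where B="2 * C"])
    have "((\<lambda>t. fun_act P t ?f z) \<longlongrightarrow> ?f z) (at_right 0)"
      using continuous_at_0 f unfolding stochastically_continuous_def by blast
    then have "\<forall>\<^sub>F t in at_right 0. dist (fun_act P t ?f z) 0 < e"
      using e by (auto dest: tendstoD)
    then obtain b where b: "0 < b" "\<And>t. 0 < t \<Longrightarrow> t < b \<Longrightarrow> dist (fun_act P t ?f z) 0 < e"
      unfolding eventually_at_right_field by auto
    have "\<forall>\<^sub>F k in sequentially. h k < b"
      using lim b(1) by (rule order_tendstoD)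
    then show "\<forall>\<^sub>F k in sequentially. dist (D k z) 0 < e"
    proof eventually_elim
      case (elim k)
      show ?case
      \<comment> \<open>Stochastic continuity is a limit along positive times; a vanishing step is covered by \<open>P 0 z = return borel z\<close>.\<close>
      proof (cases "h k = 0")
        case True
        then have "D k z = 0"
          unfolding D_def P_zero True by (subst integral_return) auto
        with e show ?thesis by simp
      next
        case False
        with b(2)[of "h k"] h[of k] elim show ?thesis
          by (simp add: D_def fun_act_def)
      qed
    qed
  qed
  have "(\<integral>\<omega>. \<bar>g (\<Phi> (s + h k) \<omega>) - g (\<Phi> s \<omega>)\<bar> \<partial>Pr x) = (\<integral>\<omega>. D k (\<Phi> s \<omega>) \<partial>Pr x)" for k
  proof -
    have [measurable]: "\<Phi> s \<in> borel_measurable (process_sigma \<Omega> \<Phi> {0..s})"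
      by (rule measurable_process_sigma) (use s in auto)
    have "(\<lambda>(\<omega>, y). \<bar>g y - g (\<Phi> s \<omega>)\<bar>) \<in> borel_measurable (process_sigma \<Omega> \<Phi> {0..s} \<Otimes>\<^sub>M borel)"
      by measurable
    from markov_integral[OF s h[of k] this, of "2 * C" x] bound show ?thesis
      by (simp add: D_def case_prod_beta)
  qed
  moreover have "(\<lambda>k. \<integral>\<omega>. D k (\<Phi> s \<omega>) \<partial>Pr x) \<longlonglongrightarrow> (\<integral>\<omega>. 0 \<partial>Pr x)"
  proof (rule integral_dominated_convergence[where w="\<lambda>_. 2 * C"])
    show "(\<lambda>\<omega>. D k (\<Phi> s \<omega>)) \<in> borel_measurable (Pr x)" for k
      using measurable_compose[OF measurable_Pr[OF s] D_meas] .
  qed (use D_lim D_le in auto)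
  ultimately show ?thesis by simp
qed

text \<open>Fubini reduces the claim to the expected increments at each time of the window, and dominated
  convergence applies to these because \<open>g\<close> is bounded.\<close>

lemma window_sample_tendsto:
  assumes n: "1 \<le> n"
  shows "(\<lambda>k. \<integral>\<omega>. \<bar>(\<integral>s. g (\<Phi> (next_grid k s) \<omega>) \<partial>window n) - (\<integral>s. g (\<Phi> s \<omega>) \<partial>window n)\<bar> \<partial>Pr x) \<longlonglongrightarrow> 0"
proof -
  interpret W: prob_space "window n" by (rule prob_space_window)
  interpret WP: pair_prob_space "window n" "Pr x" ..
  define c where "c s = max 0 (min (real n) s)" for s
  have c_id: "c s = s" if "s \<in> space (window n)" for s using that n by (auto simp: c_def)
  have grid_in: "next_grid k s \<in> space (window n)" if "s \<in> space (window n)" for k s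
    using that next_grid_le[of s n k] next_grid_bounds(1)[of s k] by auto
  define D where "D k s \<omega> = \<bar>g (\<Phi> (c (next_grid k s)) \<omega>) - g (\<Phi> (c s) \<omega>)\<bar>" for k s \<omega>
  have D_meas: "case_prod (D k) \<in> borel_measurable (window n \<Otimes>\<^sub>M Pr x)" for k
    using path_integral_measurable(1)[OF n next_grid_measurable grid_in, of k x]
      path_integral_measurable(1)[OF n, of "\<lambda>s. s" x]
    unfolding D_def c_def by (simp add: case_prod_beta)
  have D_le: "\<bar>D k s \<omega>\<bar> \<le> 2 * C" for k s \<omega>
    using g_bounded[of "\<Phi> (c (next_grid k s)) \<omega>"] g_bounded[of "\<Phi> (c s) \<omega>"] unfolding D_def by linarith
  have D_meas1: "(\<lambda>s. D k s \<omega>) \<in> borel_measurable (window n)" if "\<omega> \<in> space (Pr x)" for k \<omega>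
    using measurable_compose[OF measurable_Pair2'[OF that] D_meas[of k]] by simp
  have D_meas2: "D k s \<in> borel_measurable (Pr x)" if "s \<in> space (window n)" for k s
    using measurable_compose[OF measurable_Pair1'[OF that] D_meas[of k]] by simp
  define e where "e k = (\<integral>s. (\<integral>\<omega>. D k s \<omega> \<partial>Pr x) \<partial>window n)" for k
  have inner_meas: "(\<lambda>s. \<integral>\<omega>. D k s \<omega> \<partial>Pr x) \<in> borel_measurable (window n)" for k
    using Pr.borel_measurable_lebesgue_integral[OF D_meas[of k]] .
  have outer_meas: "(\<lambda>\<omega>. \<integral>s. D k s \<omega> \<partial>window n) \<in> borel_measurable (Pr x)" for k
  proof -
    have "(\<lambda>(\<omega>, s). D k s \<omega>) \<in> borel_measurable (Pr x \<Otimes>\<^sub>M window n)"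
      using D_meas[of k] by (subst measurable_pair_swap_iff) (simp add: case_prod_beta)
    from W.borel_measurable_lebesgue_integral[OF this] show ?thesis .
  qed
  have le: "(\<integral>\<omega>. \<bar>(\<integral>s. g (\<Phi> (next_grid k s) \<omega>) \<partial>window n) - (\<integral>s. g (\<Phi> s \<omega>) \<partial>window n)\<bar> \<partial>Pr x) \<le> e k" for k
  proof -
    have "(\<integral>\<omega>. \<bar>(\<integral>s. g (\<Phi> (next_grid k s) \<omega>) \<partial>window n) - (\<integral>s. g (\<Phi> s \<omega>) \<partial>window n)\<bar> \<partial>Pr x) \<le>
        (\<integral>\<omega>. (\<integral>s. D k s \<omega> \<partial>window n) \<partial>Pr x)"
    proof (rule integral_mono')
      show "integrable (Pr x) (\<lambda>\<omega>. \<integral>s. D k s \<omega> \<partial>window n)"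
        using W.abs_integral_le_const(2)[OF D_meas1 D_le]
        by (intro Pr.abs_integral_le_const(1)[OF outer_meas, where C="2 * C"]) auto
    next
      fix \<omega> assume \<omega>: "\<omega> \<in> space (Pr x)"
      have int: "integrable (window n) (\<lambda>s. g (\<Phi> (c (\<tau> s)) \<omega>))"
        if "\<tau> \<in> borel_measurable borel" "\<And>s. s \<in> space (window n) \<Longrightarrow> \<tau> s \<in> space (window n)" for \<tau>
        using measurable_compose[OF measurable_Pair2'[OF \<omega>] path_integral_measurable(1)[OF n that]] g_bounded
        by (intro W.abs_integral_le_const(1)[where C=C]) (auto simp: c_def)
      have "(\<integral>s. g (\<Phi> (next_grid k s) \<omega>) \<partial>window n) = (\<integral>s. g (\<Phi> (c (next_grid k s)) \<omega>) \<partial>window n)"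
        by (rule Bochner_Integration.integral_cong) (simp_all only: c_id grid_in)
      moreover have "(\<integral>s. g (\<Phi> s \<omega>) \<partial>window n) = (\<integral>s. g (\<Phi> (c s) \<omega>) \<partial>window n)"
        by (rule Bochner_Integration.integral_cong) (simp_all only: c_id)
      ultimately have "(\<integral>s. g (\<Phi> (next_grid k s) \<omega>) \<partial>window n) - (\<integral>s. g (\<Phi> s \<omega>) \<partial>window n) =
          (\<integral>s. g (\<Phi> (c (next_grid k s)) \<omega>) - g (\<Phi> (c s) \<omega>) \<partial>window n)"
        using int[OF next_grid_measurable grid_in] int[of "\<lambda>s. s"] by simp
      then show "\<bar>(\<integral>s. g (\<Phi> (next_grid k s) \<omega>) \<partial>window n) - (\<integral>s. g (\<Phi> s \<omega>) \<partial>window n)\<bar> \<le>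
          (\<integral>s. D k s \<omega> \<partial>window n)"
        unfolding D_def by simp
      show "0 \<le> (\<integral>s. D k s \<omega> \<partial>window n)"
        by (simp add: D_def)
    qed
    also have "\<dots> = e k"
      unfolding e_def using D_meas D_le
      by (intro WP.Fubini_integral WP.P.abs_integral_le_const(1)[where C="2 * C"]) auto
    finally show ?thesis .
  qed
  have "e \<longlonglongrightarrow> (\<integral>s. 0 \<partial>window n)"
    unfolding e_def
  proof (rule integral_dominated_convergence[where w="\<lambda>_. 2 * C"])
    show "AE s in window n. (\<lambda>k. \<integral>\<omega>. D k s \<omega> \<partial>Pr x) \<longlonglongrightarrow> 0"
    proof (rule AE_I2)
      fix s assume s: "s \<in> space (window n)"
      have "0 \<le> s" using s n by auto
      from increment_tendsto[OF this _ next_grid_tendsto[of s], of x] next_grid_bounds(1)[of s]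
      show "(\<lambda>k. \<integral>\<omega>. D k s \<omega> \<partial>Pr x) \<longlonglongrightarrow> 0"
        unfolding D_def c_id[OF s] c_id[OF grid_in[OF s]] by simp
    qed
    show "AE s in window n. norm (\<integral>\<omega>. D k s \<omega> \<partial>Pr x) \<le> 2 * C" for k
      unfolding real_norm_def by (intro AE_I2 Pr.abs_integral_le_const(2) D_meas2 D_le)
  qed (use inner_meas in auto)
  then have e: "e \<longlonglongrightarrow> 0" by simp
  show ?thesis
    by (rule tendsto_sandwich[OF _ _ tendsto_const e]) (auto simp: le)
qed

end

section \<open>Functionals of the martingale increments\<close>

context observed_process
begin

lemma Z_eq: "Z P \<Phi> g n \<omega> =
    chi P g (\<Phi> (real n) \<omega>) - chi P g (\<Phi> (real n - 1) \<omega>) + (\<integral>s. g (\<Phi> s \<omega>) \<partial>window n)"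
  unfolding Z_def integral_window ..

text \<open>The increment \<open>Z\<^sub>n\<close> with its window integral replaced by a sampled one, as a function of the whole
  path, which it evaluates at finitely many times only.\<close>

definition Z_sampled :: "nat \<Rightarrow> nat \<Rightarrow> (real \<Rightarrow> 'a) \<Rightarrow> real" where
  "Z_sampled k n \<phi> =
    chi P g (\<phi> (real n)) - chi P g (\<phi> (real n - 1)) + (\<integral>s. g (\<phi> (next_grid k s)) \<partial>window n)"

lemma Z_measurable:
  assumes n: "1 \<le> n"
  shows "Z P \<Phi> g n \<in> borel_measurable (Pr x)"
    and "(\<lambda>\<omega>. Z_sampled k n (\<lambda>t. \<Phi> t \<omega>)) \<in> borel_measurable (Pr x)"
proof -
  have [measurable]: "\<Phi> (real n) \<in> borel_measurable (Pr x)" "\<Phi> (real n - 1) \<in> borel_measurable (Pr x)"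
    using n by (auto intro!: measurable_Pr)
  have [measurable]: "(\<lambda>\<omega>. \<integral>s. g (\<Phi> s \<omega>) \<partial>window n) \<in> borel_measurable (Pr x)"
    by (rule path_integral_measurable(2)[OF n]) auto
  have [measurable]: "(\<lambda>\<omega>. \<integral>s. g (\<Phi> (next_grid k s) \<omega>) \<partial>window n) \<in> borel_measurable (Pr x)"
    using next_grid_le[of _ n k] next_grid_bounds(1)[of _ k]
    by (intro path_integral_measurable(2)[OF n next_grid_measurable]) (auto intro: order_trans)
  show "Z P \<Phi> g n \<in> borel_measurable (Pr x)"
    unfolding Z_eq[abs_def] by measurable
  show "(\<lambda>\<omega>. Z_sampled k n (\<lambda>t. \<Phi> t \<omega>)) \<in> borel_measurable (Pr x)"
    unfolding Z_sampled_def by measurable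
qed

lemma path_lipschitz_Z_sampled:
  assumes n: "1 \<le> n"
  shows "path_lipschitz \<gamma> (Z_sampled k n) ((2 * L / \<gamma> + L) * exp (- \<gamma> * (real n - 1)))"
proof -
  have chi0: "0 \<le> L / \<gamma>" using L_nonneg rate_pos by simp
  have 1: "path_lipschitz \<gamma> (\<lambda>\<phi>. chi P g (\<phi> (real n)) - chi P g (\<phi> (real n - 1)))
      (L / \<gamma> * exp (- \<gamma> * real n) + L / \<gamma> * exp (- \<gamma> * (real n - 1)))"
    by (rule path_lipschitz_plus[OF path_lipschitz_eval[OF _ chi0 chi_lipschitz] path_lipschitz_eval[OF _ chi0 chi_lipschitz]])
       (use n in auto)
  have 2: "path_lipschitz \<gamma> (Z_sampled k n)
      (L / \<gamma> * exp (- \<gamma> * real n) + L / \<gamma> * exp (- \<gamma> * (real n - 1)) + L * exp (- \<gamma> * (real n - 1)))"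
    by (rule path_lipschitz_plus[OF 1 path_lipschitz_window_sample[where k=k, OF n L_nonneg g_lipschitz less_imp_le[OF rate_pos]]])
       (auto simp: Z_sampled_def)
  have "L / \<gamma> * exp (- \<gamma> * real n) \<le> L / \<gamma> * exp (- \<gamma> * (real n - 1))"
    using rate_pos chi0 by (intro mult_left_mono) auto
  moreover have "(2 * L / \<gamma> + L) * e = L / \<gamma> * e + L / \<gamma> * e + L * e" for e
    by (simp add: distrib_right add_divide_distrib[symmetric])
  ultimately have "L / \<gamma> * exp (- \<gamma> * real n) + L / \<gamma> * exp (- \<gamma> * (real n - 1)) + L * exp (- \<gamma> * (real n - 1)) \<le>
      (2 * L / \<gamma> + L) * exp (- \<gamma> * (real n - 1))"
    by (simp only: add_right_mono)
  with 2 show ?thesis by (rule path_lipschitz_mono)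
qed

lemma Z_sampled_tendsto:
  assumes n: "1 \<le> n"
  shows "integrable (Pr x) (\<lambda>\<omega>. \<bar>Z_sampled k n (\<lambda>t. \<Phi> t \<omega>) - Z P \<Phi> g n \<omega>\<bar>)"
    and "(\<lambda>k. \<integral>\<omega>. \<bar>Z_sampled k n (\<lambda>t. \<Phi> t \<omega>) - Z P \<Phi> g n \<omega>\<bar> \<partial>Pr x) \<longlonglongrightarrow> 0"
proof -
  interpret W: prob_space "window n" by (rule prob_space_window)
  have C: "0 \<le> C" using g_bounded[of undefined] by linarith
  have eq: "Z_sampled k n (\<lambda>t. \<Phi> t \<omega>) - Z P \<Phi> g n \<omega> =
      (\<integral>s. g (\<Phi> (next_grid k s) \<omega>) \<partial>window n) - (\<integral>s. g (\<Phi> s \<omega>) \<partial>window n)" for k \<omega>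
    unfolding Z_eq Z_sampled_def by simp
  show "(\<lambda>k. \<integral>\<omega>. \<bar>Z_sampled k n (\<lambda>t. \<Phi> t \<omega>) - Z P \<Phi> g n \<omega>\<bar> \<partial>Pr x) \<longlonglongrightarrow> 0"
    unfolding eq by (rule window_sample_tendsto[OF n])
  have le: "\<bar>\<integral>s. g (f s) \<partial>window n\<bar> \<le> C" for f
  proof (cases "integrable (window n) (\<lambda>s. g (f s))")
    case True
    then show ?thesis
      by (intro W.abs_integral_le_const(2)) (auto simp: g_bounded)
  qed (simp add: not_integrable_integral_eq C)
  show "integrable (Pr x) (\<lambda>\<omega>. \<bar>Z_sampled k n (\<lambda>t. \<Phi> t \<omega>) - Z P \<Phi> g n \<omega>\<bar>)"
  proof (rule Pr.abs_integral_le_const(1)[where C="2 * C"])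
    show "\<bar>\<bar>Z_sampled k n (\<lambda>t. \<Phi> t \<omega>) - Z P \<Phi> g n \<omega>\<bar>\<bar> \<le> 2 * C" for \<omega>
      using le[of "\<lambda>s. \<Phi> (next_grid k s) \<omega>"] le[of "\<lambda>s. \<Phi> s \<omega>"] unfolding eq by linarith
  qed (use Z_measurable[OF n] in measurable)
qed

text \<open>The sampled functionals have discounted constants at most \<open>\<epsilon>\<close> times a geometric sum over \<open>n\<close>,
  uniformly in the mesh and in \<open>N\<close>, and their expectations converge to that of \<open>\<Psi>\<close> as the mesh
  shrinks.\<close>

lemma functional_contraction:
  fixes \<Psi> :: "(nat \<Rightarrow> real) \<Rightarrow> real"
  assumes \<epsilon>: "0 \<le> \<epsilon>"
    and lip: "\<And>z z'. \<bar>\<Psi> z - \<Psi> z'\<bar> \<le> \<epsilon> * (\<Sum>n=1..N. \<bar>z n - z' n\<bar>)"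
    and bound: "\<And>z. \<bar>\<Psi> z\<bar> \<le> B"
  shows "(\<lambda>\<omega>. \<Psi> (\<lambda>n. Z P \<Phi> g n \<omega>)) \<in> borel_measurable (Pr x)"
    and "\<bar>(\<integral>\<omega>. \<Psi> (\<lambda>n. Z P \<Phi> g n \<omega>) \<partial>Pr x) - (\<integral>\<omega>. \<Psi> (\<lambda>n. Z P \<Phi> g n \<omega>) \<partial>Pr y)\<bar> \<le>
      \<epsilon> * ((2 * L / \<gamma> + L) / (1 - exp (- \<gamma>))) * dist x y"
proof -
  have lip': "\<bar>\<Psi> z - \<Psi> z'\<bar> \<le> (\<Sum>n=1..N. \<epsilon> * dist (z n) (z' n))" for z z'
    using lip[of z z'] by (simp add: sum_distrib_left dist_real_def)
  define F where "F k \<phi> = \<Psi> (\<lambda>n. Z_sampled k n \<phi>)" for k \<phi>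
  have meas: "(\<lambda>\<omega>. \<Psi> (\<lambda>n. Z P \<Phi> g n \<omega>)) \<in> borel_measurable (Pr x)" for x
    by (rule borel_measurable_finite_lipschitz[OF _ lip']) (auto intro!: Z_measurable(1)[unfolded One_nat_def])
  then show "(\<lambda>\<omega>. \<Psi> (\<lambda>n. Z P \<Phi> g n \<omega>)) \<in> borel_measurable (Pr x)" .
  have meas_F: "(\<lambda>\<omega>. F k (\<lambda>t. \<Phi> t \<omega>)) \<in> borel_measurable (Pr x)" for k x
    unfolding F_def
    by (rule borel_measurable_finite_lipschitz[OF _ lip']) (auto intro!: Z_measurable(2)[unfolded One_nat_def])
  define r where "r = (\<Sum>n=1..N. \<epsilon> * ((2 * L / \<gamma> + L) * exp (- \<gamma> * (real n - 1))))"
  have F_lip: "path_lipschitz \<gamma> (F k) r" for k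
    unfolding r_def
  proof (rule path_lipschitz_combine)
    show "path_lipschitz \<gamma> (Z_sampled k n) ((2 * L / \<gamma> + L) * exp (- \<gamma> * (real n - 1)))" if "n \<in> {1..N}" for n
      using that by (intro path_lipschitz_Z_sampled) simp
    show "\<bar>F k \<phi> - F k \<psi>\<bar> \<le> (\<Sum>n=1..N. \<epsilon> * \<bar>Z_sampled k n \<phi> - Z_sampled k n \<psi>\<bar>)" for \<phi> \<psi>
      unfolding F_def using lip' by (simp add: dist_real_def)
  qed (use \<epsilon> in auto)
  have lim: "(\<lambda>k. \<integral>\<omega>. F k (\<lambda>t. \<Phi> t \<omega>) \<partial>Pr x) \<longlonglongrightarrow> (\<integral>\<omega>. \<Psi> (\<lambda>n. Z P \<Phi> g n \<omega>) \<partial>Pr x)" for x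
  proof -
    have int: "integrable (Pr x) (\<lambda>\<omega>. F k (\<lambda>t. \<Phi> t \<omega>))" "integrable (Pr x) (\<lambda>\<omega>. \<Psi> (\<lambda>n. Z P \<Phi> g n \<omega>))" for k
      using bound by (auto intro!: Pr.abs_integral_le_const(1)[where C=B] meas meas_F[unfolded F_def] simp: F_def)
    have le: "\<bar>(\<integral>\<omega>. F k (\<lambda>t. \<Phi> t \<omega>) \<partial>Pr x) - (\<integral>\<omega>. \<Psi> (\<lambda>n. Z P \<Phi> g n \<omega>) \<partial>Pr x)\<bar> \<le>
        (\<Sum>n=1..N. \<epsilon> * (\<integral>\<omega>. \<bar>Z_sampled k n (\<lambda>t. \<Phi> t \<omega>) - Z P \<Phi> g n \<omega>\<bar> \<partial>Pr x))" for k
    proof -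
      have zint: "integrable (Pr x) (\<lambda>\<omega>. \<bar>Z_sampled k n (\<lambda>t. \<Phi> t \<omega>) - Z P \<Phi> g n \<omega>\<bar>)" if "n \<in> {1..N}" for n
        using that by (intro Z_sampled_tendsto(1)) simp
      have "\<bar>(\<integral>\<omega>. F k (\<lambda>t. \<Phi> t \<omega>) \<partial>Pr x) - (\<integral>\<omega>. \<Psi> (\<lambda>n. Z P \<Phi> g n \<omega>) \<partial>Pr x)\<bar> =
          \<bar>\<integral>\<omega>. F k (\<lambda>t. \<Phi> t \<omega>) - \<Psi> (\<lambda>n. Z P \<Phi> g n \<omega>) \<partial>Pr x\<bar>"
        using int by simp
      also have "\<dots> \<le> (\<integral>\<omega>. (\<Sum>n=1..N. \<epsilon> * \<bar>Z_sampled k n (\<lambda>t. \<Phi> t \<omega>) - Z P \<Phi> g n \<omega>\<bar>) \<partial>Pr x)"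
        using int zint lip'
        by (intro abs_integral_le Bochner_Integration.integrable_sum integrable_mult_right) (auto simp: F_def dist_real_def)
      also have "\<dots> = (\<Sum>n=1..N. \<integral>\<omega>. \<epsilon> * \<bar>Z_sampled k n (\<lambda>t. \<Phi> t \<omega>) - Z P \<Phi> g n \<omega>\<bar> \<partial>Pr x)"
        using zint by (intro Bochner_Integration.integral_sum integrable_mult_right) auto
      finally show ?thesis by simp
    qed
    have "(\<lambda>k. \<Sum>n=1..N. \<epsilon> * (\<integral>\<omega>. \<bar>Z_sampled k n (\<lambda>t. \<Phi> t \<omega>) - Z P \<Phi> g n \<omega>\<bar> \<partial>Pr x)) \<longlonglongrightarrow> (\<Sum>n=1..N. \<epsilon> * 0)"
      by (intro tendsto_sum tendsto_mult tendsto_const Z_sampled_tendsto(2)) auto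
    then have null: "(\<lambda>k. \<Sum>n=1..N. \<epsilon> * (\<integral>\<omega>. \<bar>Z_sampled k n (\<lambda>t. \<Phi> t \<omega>) - Z P \<Phi> g n \<omega>\<bar> \<partial>Pr x)) \<longlonglongrightarrow> 0"
      by simp
    have "(\<lambda>k. (\<integral>\<omega>. F k (\<lambda>t. \<Phi> t \<omega>) \<partial>Pr x) - (\<integral>\<omega>. \<Psi> (\<lambda>n. Z P \<Phi> g n \<omega>) \<partial>Pr x)) \<longlonglongrightarrow> 0"
      by (rule Lim_null_comparison[OF always_eventually null]) (simp only: real_norm_def le simp_thms)
    then show ?thesis by (rule LIM_zero_cancel)
  qed
  have "\<bar>(\<integral>\<omega>. \<Psi> (\<lambda>n. Z P \<Phi> g n \<omega>) \<partial>Pr x) - (\<integral>\<omega>. \<Psi> (\<lambda>n. Z P \<Phi> g n \<omega>) \<partial>Pr y)\<bar> \<le> r * dist x y"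
  proof (rule LIMSEQ_le_const2)
    show "(\<lambda>k. \<bar>(\<integral>\<omega>. F k (\<lambda>t. \<Phi> t \<omega>) \<partial>Pr x) - (\<integral>\<omega>. F k (\<lambda>t. \<Phi> t \<omega>) \<partial>Pr y)\<bar>) \<longlonglongrightarrow>
        \<bar>(\<integral>\<omega>. \<Psi> (\<lambda>n. Z P \<Phi> g n \<omega>) \<partial>Pr x) - (\<integral>\<omega>. \<Psi> (\<lambda>n. Z P \<Phi> g n \<omega>) \<partial>Pr y)\<bar>"
      by (intro tendsto_rabs tendsto_diff lim)
    show "\<exists>K. \<forall>k\<ge>K. \<bar>(\<integral>\<omega>. F k (\<lambda>t. \<Phi> t \<omega>) \<partial>Pr x) - (\<integral>\<omega>. F k (\<lambda>t. \<Phi> t \<omega>) \<partial>Pr y)\<bar> \<le> r * dist x y"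
      using expectation_contraction[OF F_lip, where B=B] bound by (auto simp: F_def)
  qed
  also have "\<dots> \<le> \<epsilon> * ((2 * L / \<gamma> + L) / (1 - exp (- \<gamma>))) * dist x y"
  proof (rule mult_right_mono)
    define q where "q = exp (- \<gamma>)"
    have q: "0 \<le> q" "q < 1" using rate_pos by (auto simp: q_def)
    have "(\<Sum>n=1..N. exp (- \<gamma> * (real n - 1))) = (\<Sum>n<N. q ^ n)"
      by (rule sum.reindex_bij_witness[where i=Suc and j="\<lambda>n. n - 1"])
         (auto simp: q_def exp_of_nat_mult[symmetric] of_nat_diff algebra_simps)
    also have "\<dots> \<le> (\<Sum>n. q ^ n)"
      using q by (intro sum_le_suminf summable_geometric) auto
    also have "\<dots> = 1 / (1 - q)"
      using q by (intro suminf_geometric) auto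
    finally have sum: "(\<Sum>n=1..N. exp (- \<gamma> * (real n - 1))) \<le> 1 / (1 - q)" .
    have "r = \<epsilon> * (2 * L / \<gamma> + L) * (\<Sum>n=1..N. exp (- \<gamma> * (real n - 1)))"
      unfolding r_def by (simp add: sum_distrib_left mult.assoc)
    also have "\<dots> \<le> \<epsilon> * (2 * L / \<gamma> + L) * (1 / (1 - q))"
      using \<epsilon> L_nonneg rate_pos by (intro mult_left_mono[OF sum]) auto
    finally show "r \<le> \<epsilon> * ((2 * L / \<gamma> + L) / (1 - exp (- \<gamma>)))"
      by (simp add: q_def)
  qed simp
  finally show "\<bar>(\<integral>\<omega>. \<Psi> (\<lambda>n. Z P \<Phi> g n \<omega>) \<partial>Pr x) - (\<integral>\<omega>. \<Psi> (\<lambda>n. Z P \<Phi> g n \<omega>) \<partial>Pr y)\<bar> \<le>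
      \<epsilon> * ((2 * L / \<gamma> + L) / (1 - exp (- \<gamma>))) * dist x y" .
qed

text \<open>A quantity obtained by a double limit from functionals whose Lipschitz constants vanish in the
  outer limit has the same expectation from every starting point.  The constant may not depend on
  the inner index \<open>M\<close>, while the number \<open>N m M\<close> of coordinates may grow with it.\<close>

lemma tail_functional_independent_of_start:
  fixes \<Theta> :: "nat \<Rightarrow> nat \<Rightarrow> (nat \<Rightarrow> real) \<Rightarrow> real"
  assumes lip: "\<And>m M z z'. \<bar>\<Theta> m M z - \<Theta> m M z'\<bar> \<le> \<epsilon> m * (\<Sum>n=1..N m M. \<bar>z n - z' n\<bar>)"
    and \<epsilon>: "\<And>m. 0 \<le> \<epsilon> m" "\<epsilon> \<longlonglongrightarrow> 0"
    and bound: "\<And>m M z. \<bar>\<Theta> m M z\<bar> \<le> B"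
    and lim1: "\<And>m z. (\<lambda>M. \<Theta> m M z) \<longlonglongrightarrow> \<Theta>1 m z"
    and lim2: "\<And>z. (\<lambda>m. \<Theta>1 m z) \<longlonglongrightarrow> \<Theta>2 z"
  shows "(\<lambda>\<omega>. \<Theta>2 (\<lambda>n. Z P \<Phi> g n \<omega>)) \<in> borel_measurable (Pr x)"
    and "(\<integral>\<omega>. \<Theta>2 (\<lambda>n. Z P \<Phi> g n \<omega>) \<partial>Pr x) = (\<integral>\<omega>. \<Theta>2 (\<lambda>n. Z P \<Phi> g n \<omega>) \<partial>Pr y)"
proof -
  let ?Z = "\<lambda>\<omega> n. Z P \<Phi> g n \<omega>"
  have meas0: "(\<lambda>\<omega>. \<Theta> m M (?Z \<omega>)) \<in> borel_measurable (Pr x)" for m M x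
    by (rule functional_contraction(1)[OF \<epsilon>(1) lip bound])
  have meas1: "(\<lambda>\<omega>. \<Theta>1 m (?Z \<omega>)) \<in> borel_measurable (Pr x)" for m x
    using lim1 meas0 by (rule borel_measurable_LIMSEQ_real)
  have meas2: "(\<lambda>\<omega>. \<Theta>2 (?Z \<omega>)) \<in> borel_measurable (Pr x)" for x
    using lim2 meas1 by (rule borel_measurable_LIMSEQ_real)
  then show "(\<lambda>\<omega>. \<Theta>2 (?Z \<omega>)) \<in> borel_measurable (Pr x)" .
  have bound1: "\<bar>\<Theta>1 m z\<bar> \<le> B" for m z
    by (rule LIMSEQ_le_const2[OF tendsto_rabs[OF lim1]]) (use bound in auto)
  have int1: "(\<lambda>M. \<integral>\<omega>. \<Theta> m M (?Z \<omega>) \<partial>Pr x) \<longlonglongrightarrow> (\<integral>\<omega>. \<Theta>1 m (?Z \<omega>) \<partial>Pr x)" for m x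
    by (rule integral_dominated_convergence[where w="\<lambda>_. B"]) (use meas0 meas1 lim1 bound in auto)
  have int2: "(\<lambda>m. \<integral>\<omega>. \<Theta>1 m (?Z \<omega>) \<partial>Pr x) \<longlonglongrightarrow> (\<integral>\<omega>. \<Theta>2 (?Z \<omega>) \<partial>Pr x)" for x
    by (rule integral_dominated_convergence[where w="\<lambda>_. B"]) (use meas1 meas2 lim2 bound1 in auto)
  define D where "D = (2 * L / \<gamma> + L) / (1 - exp (- \<gamma>))"
  have le1: "\<bar>(\<integral>\<omega>. \<Theta>1 m (?Z \<omega>) \<partial>Pr x) - (\<integral>\<omega>. \<Theta>1 m (?Z \<omega>) \<partial>Pr y)\<bar> \<le> \<epsilon> m * D * dist x y" for m
    by (rule LIMSEQ_le_const2[OF tendsto_rabs[OF tendsto_diff[OF int1 int1]]])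
       (use functional_contraction(2)[OF \<epsilon>(1) lip bound] in \<open>auto simp: D_def\<close>)
  have "(\<lambda>m. \<epsilon> m * D * dist x y) \<longlonglongrightarrow> 0 * D * dist x y"
    by (intro tendsto_mult tendsto_const \<epsilon>(2))
  from LIMSEQ_le[OF tendsto_rabs[OF tendsto_diff[OF int2[of x] int2[of y]]] this] le1
  show "(\<integral>\<omega>. \<Theta>2 (?Z \<omega>) \<partial>Pr x) = (\<integral>\<omega>. \<Theta>2 (?Z \<omega>) \<partial>Pr y)"
    by fastforce
qed

end

section \<open>Averages of truncated squares\<close>

definition truncated_abs :: "enat \<Rightarrow> real \<Rightarrow> real" where
  "truncated_abs p a = (case p of enat m \<Rightarrow> min \<bar>a\<bar> (sqrt (real m)) | \<infinity> \<Rightarrow> \<bar>a\<bar>)"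

definition avg_sq :: "enat \<Rightarrow> nat \<Rightarrow> nat \<Rightarrow> (nat \<Rightarrow> real) \<Rightarrow> real" where
  "avg_sq p i n z = 1 / real n * (\<Sum>k=1..n. trunc ((z (2 * k + i))\<^sup>2) p)"

text \<open>Truncating the square at \<open>p\<close> is squaring after truncation at \<open>sqrt p\<close>, so, up to the
  factor \<open>1 / n\<close>, the average is a squared Euclidean norm of 1-Lipschitz functions of the coordinates.\<close>

lemma trunc_square: "trunc (a\<^sup>2) p = (truncated_abs p a)\<^sup>2"
proof (cases p)
  case (enat m)
  have "a\<^sup>2 \<le> real m \<longleftrightarrow> \<bar>a\<bar> \<le> sqrt (real m)"
    using real_le_rsqrt[of "\<bar>a\<bar>" "real m"] sqrt_le_D
    by (auto simp: real_sqrt_le_iff[symmetric, of "a\<^sup>2"] simp del: real_sqrt_le_iff)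
  then show ?thesis
    by (auto simp: trunc_def truncated_abs_def enat min_def)
qed (simp add: trunc_def truncated_abs_def)

lemma truncated_abs_lipschitz: "\<bar>truncated_abs p a - truncated_abs p b\<bar> \<le> \<bar>a - b\<bar>"
  by (cases p) (auto simp: truncated_abs_def min_def)

lemma avg_sq_nonneg: "0 \<le> avg_sq p i n z"
  unfolding avg_sq_def trunc_square by (intro mult_nonneg_nonneg sum_nonneg) auto

lemma L2_set_diff_le: "\<bar>L2_set f A - L2_set g A\<bar> \<le> (\<Sum>i\<in>A. \<bar>f i - g i\<bar>)"
proof -
  have "L2_set f A \<le> L2_set (\<lambda>i. f i - g i) A + L2_set g A"
    using L2_set_triangle_ineq[of "\<lambda>i. f i - g i" g A] by simp
  moreover have "L2_set g A \<le> L2_set (\<lambda>i. g i - f i) A + L2_set f A"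
    using L2_set_triangle_ineq[of "\<lambda>i. g i - f i" f A] by simp
  moreover have "L2_set (\<lambda>i. f i - g i) A \<le> (\<Sum>i\<in>A. \<bar>f i - g i\<bar>)"
    by (rule L2_set_le_sum_abs)
  moreover have "L2_set (\<lambda>i. g i - f i) A \<le> (\<Sum>i\<in>A. \<bar>f i - g i\<bar>)"
    using L2_set_le_sum_abs[of "\<lambda>i. g i - f i" A] by (simp add: abs_minus_commute)
  ultimately show ?thesis by linarith
qed

text \<open>Taking the square root is what makes the estimate uniform in the truncation level: for \<open>p = \<infinity>\<close> the
  average itself is not Lipschitz.\<close>

lemma sqrt_avg_sq_lipschitz:
  "\<bar>sqrt (avg_sq p i n z) - sqrt (avg_sq p i n z')\<bar> \<le>
    1 / sqrt (real n) * (\<Sum>k=1..n. \<bar>z (2 * k + i) - z' (2 * k + i)\<bar>)"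
proof -
  have eq: "sqrt (avg_sq p i n z) = 1 / sqrt (real n) * L2_set (\<lambda>k. truncated_abs p (z (2 * k + i))) {1..n}" for z
    unfolding avg_sq_def trunc_square L2_set_def by (simp add: real_sqrt_mult real_sqrt_divide)
  have "\<bar>sqrt (avg_sq p i n z) - sqrt (avg_sq p i n z')\<bar> =
      1 / sqrt (real n) * \<bar>L2_set (\<lambda>k. truncated_abs p (z (2 * k + i))) {1..n} -
        L2_set (\<lambda>k. truncated_abs p (z' (2 * k + i))) {1..n}\<bar>"
    unfolding eq by (simp add: abs_mult flip: right_diff_distrib diff_divide_distrib)
  also have "\<dots> \<le> 1 / sqrt (real n) * (\<Sum>k=1..n. \<bar>z (2 * k + i) - z' (2 * k + i)\<bar>)"
    by (intro mult_left_mono order_trans[OF L2_set_diff_le] sum_mono truncated_abs_lipschitz) simp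
  finally show ?thesis .
qed

text \<open>The cap at \<open>1\<close> makes \<open>min \<bar>a - d\<bar> 1\<close> constant in \<open>a\<close> beyond \<open>d + 1\<close>, and below \<open>d + 1\<close> the
  function \<open>a = (sqrt a)\<^sup>2\<close> of \<open>sqrt a\<close> has derivative at most \<open>2 * sqrt (d + 1)\<close>.\<close>

lemma capped_distance_lipschitz:
  fixes a b d :: real
  assumes a: "0 \<le> a" and b: "0 \<le> b" and d: "0 \<le> d"
  shows "\<bar>min \<bar>a - d\<bar> 1 - min \<bar>b - d\<bar> 1\<bar> \<le> 2 * sqrt (d + 1) * \<bar>sqrt a - sqrt b\<bar>"
proof -
  have main: "\<bar>min \<bar>a - d\<bar> 1 - min \<bar>b - d\<bar> 1\<bar> \<le> 2 * sqrt (d + 1) * \<bar>sqrt a - sqrt b\<bar>"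
    if ab: "a \<le> b" "0 \<le> a" for a b
  proof (cases "d + 1 \<le> a")
    case True
    then have "\<bar>min \<bar>a - d\<bar> 1 - min \<bar>b - d\<bar> 1\<bar> = 0" using ab by auto
    also have "\<dots> \<le> 2 * sqrt (d + 1) * \<bar>sqrt a - sqrt b\<bar>" using d by simp
    finally show ?thesis .
  next
    case False
    define c where "c = min b (d + 1)"
    have c: "a \<le> c" "c \<le> d + 1" "c \<le> b" using ab False by (auto simp: c_def)
    have "\<bar>min \<bar>a - d\<bar> 1 - min \<bar>b - d\<bar> 1\<bar> = \<bar>min \<bar>a - d\<bar> 1 - min \<bar>c - d\<bar> 1\<bar>"
      by (auto simp: c_def min_def)
    also have "\<dots> \<le> c - a" using c(1) by (auto simp: min_def)
    also have "\<dots> = (sqrt c + sqrt a) * (sqrt c - sqrt a)"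
      using ab c by (simp add: algebra_simps)
    also have "\<dots> \<le> (2 * sqrt (d + 1)) * (sqrt b - sqrt a)"
    proof (rule mult_mono)
      have "sqrt c \<le> sqrt (d + 1)" "sqrt a \<le> sqrt (d + 1)"
        using c by (auto simp: real_sqrt_le_iff)
      then show "sqrt c + sqrt a \<le> 2 * sqrt (d + 1)" by linarith
    qed (use c ab d in auto)
    also have "\<dots> = 2 * sqrt (d + 1) * \<bar>sqrt a - sqrt b\<bar>"
      using ab by simp
    finally show ?thesis .
  qed
  show ?thesis
  proof (cases "a \<le> b")
    case True
    then show ?thesis using main a by blast
  next
    case False
    then show ?thesis using main[of b a] b by (simp add: abs_minus_commute)
  qed
qed

section \<open>Lower and upper limits as double limits of window extrema\<close>

lemma extremum_nonexpansive:
  fixes f f' :: "'i \<Rightarrow> real"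
  assumes ext: "ext = Min \<or> ext = Max" and J: "finite J" "J \<noteq> {}"
    and le: "\<And>j. j \<in> J \<Longrightarrow> \<bar>f j - f' j\<bar> \<le> \<delta>"
  shows "\<bar>ext (f ` J) - ext (f' ` J)\<bar> \<le> \<delta>"
proof -
  have fin: "finite (f ` J)" "f ` J \<noteq> {}" for f :: "'i \<Rightarrow> real" using J by auto
  have Min: "Min (f ` J) - \<delta> \<le> Min (f' ` J)"
    if le: "\<And>j. j \<in> J \<Longrightarrow> \<bar>f j - f' j\<bar> \<le> \<delta>" for f f' :: "'i \<Rightarrow> real"
  proof -
    obtain j where j: "j \<in> J" "Min (f' ` J) = f' j"
      using Min_in[OF fin[of f']] by auto
    have "Min (f ` J) \<le> f j" using J j by simp
    with le[OF j(1)] j(2) show ?thesis by linarith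
  qed
  have Max: "Max (f ` J) \<le> Max (f' ` J) + \<delta>"
    if le: "\<And>j. j \<in> J \<Longrightarrow> \<bar>f j - f' j\<bar> \<le> \<delta>" for f f' :: "'i \<Rightarrow> real"
  proof -
    obtain j where j: "j \<in> J" "Max (f ` J) = f j"
      using Max_in[OF fin[of f]] by auto
    have "f' j \<le> Max (f' ` J)" using J j by simp
    with le[OF j(1)] j(2) show ?thesis by linarith
  qed
  have le': "\<bar>f' j - f j\<bar> \<le> \<delta>" if "j \<in> J" for j using le[OF that] by (simp add: abs_minus_commute)
  show ?thesis
    using ext Min[of f f', OF le] Min[of f' f, OF le'] Max[of f f', OF le] Max[of f' f, OF le'] by (auto simp: abs_le_iff)
qed

lemma extremum_mono_commute:
  fixes f :: "'i \<Rightarrow> 'b::linorder" and h :: "'b \<Rightarrow> 'c::linorder"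
  assumes "mono h" "finite J" "J \<noteq> {}"
  shows "h (Min (f ` J)) = Min ((\<lambda>j. h (f j)) ` J)" "h (Max (f ` J)) = Max ((\<lambda>j. h (f j)) ` J)"
  using mono_Min_commute[of h "f ` J"] mono_Max_commute[of h "f ` J"] assms by (simp_all add: image_image)

text \<open>The integrand of \<open>I_fun\<close> and \<open>S_fun\<close> as a function of the extended real limit.  It is continuous on
  all extended reals, with value \<open>1\<close> at \<open>\<plusminus>\<infinity>\<close>.\<close>

definition capped_deviation :: "real \<Rightarrow> ereal \<Rightarrow> real" where
  "capped_deviation d e = real_of_ereal (min \<bar>e - ereal d\<bar> 1)"

lemma capped_deviation_ereal: "capped_deviation d (ereal a) = min \<bar>a - d\<bar> 1"
  unfolding capped_deviation_def by (simp add: one_ereal_def min_def)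

lemma capped_deviation_bounds: "0 \<le> capped_deviation d e" "capped_deviation d e \<le> 1"
proof -
  have "0 \<le> min \<bar>e - ereal d\<bar> 1" "min \<bar>e - ereal d\<bar> 1 \<le> 1" by auto
  then show "0 \<le> capped_deviation d e" "capped_deviation d e \<le> 1"
    unfolding capped_deviation_def
    by (cases "min \<bar>e - ereal d\<bar> 1"; simp add: one_ereal_def zero_ereal_def)+
qed

lemma capped_deviation_tendsto:
  assumes "(X \<longlongrightarrow> e) F" shows "((\<lambda>n. capped_deviation d (X n)) \<longlongrightarrow> capped_deviation d e) F"
proof -
  let ?Y = "\<lambda>e. min \<bar>e - ereal d\<bar> 1"
  have "0 \<le> ?Y e" "?Y e \<le> 1" by auto
  then have "\<bar>?Y e\<bar> \<noteq> \<infinity>" by (cases "?Y e") auto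
  then have "?Y e = ereal (capped_deviation d e)"
    unfolding capped_deviation_def by (simp add: ereal_real)
  moreover have "((\<lambda>n. ?Y (X n)) \<longlongrightarrow> ?Y e) F"
    by (intro tendsto_min tendsto_abs_ereal tendsto_diff_ereal_general tendsto_const assms) auto
  ultimately show ?thesis
    unfolding capped_deviation_def[of d "X _"] by (intro lim_real_of_ereal) simp
qed

lemma Min_window_tendsto:
  fixes a :: "nat \<Rightarrow> real"
  shows "(\<lambda>M. ereal (Min (a ` {m..m + M}))) \<longlonglongrightarrow> (INF n\<in>{m..}. ereal (a n))"
proof -
  have eq: "ereal (Min (a ` {m..m + M})) = (INF n\<in>{m..m + M}. ereal (a n))" for M
    by (subst extremum_mono_commute(1)) (auto simp: mono_def Min_Inf)
  have "decseq (\<lambda>M. INF n\<in>{m..m + M}. ereal (a n))"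
    by (auto simp: decseq_def intro!: INF_superset_mono)
  from LIMSEQ_INF[OF this]
  have "(\<lambda>M. INF n\<in>{m..m + M}. ereal (a n)) \<longlonglongrightarrow> (INF M. INF n\<in>{m..m + M}. ereal (a n))" .
  also have "(INF M. INF n\<in>{m..m + M}. ereal (a n)) = (INF n\<in>{m..}. ereal (a n))"
  proof (rule antisym)
    show "(INF M. INF n\<in>{m..m + M}. ereal (a n)) \<le> (INF n\<in>{m..}. ereal (a n))"
    proof (rule INF_greatest)
      fix n assume "n \<in> {m..}"
      then show "(INF M. INF n\<in>{m..m + M}. ereal (a n)) \<le> ereal (a n)"
        by (intro INF_lower2[of "n - m" UNIV] INF_lower) auto
    qed
  qed (intro INF_greatest INF_lower, auto)
  finally show ?thesis unfolding eq .
qed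

lemma Max_window_tendsto:
  fixes a :: "nat \<Rightarrow> real"
  shows "(\<lambda>M. ereal (Max (a ` {m..m + M}))) \<longlonglongrightarrow> (SUP n\<in>{m..}. ereal (a n))"
proof -
  have eq: "ereal (Max (a ` {m..m + M})) = (SUP n\<in>{m..m + M}. ereal (a n))" for M
    by (subst extremum_mono_commute(2)) (auto simp: mono_def Max_Sup)
  have "incseq (\<lambda>M. SUP n\<in>{m..m + M}. ereal (a n))"
    by (auto simp: incseq_def intro!: SUP_subset_mono)
  from LIMSEQ_SUP[OF this]
  have "(\<lambda>M. SUP n\<in>{m..m + M}. ereal (a n)) \<longlonglongrightarrow> (SUP M. SUP n\<in>{m..m + M}. ereal (a n))" .
  also have "(SUP M. SUP n\<in>{m..m + M}. ereal (a n)) = (SUP n\<in>{m..}. ereal (a n))"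
  proof (rule antisym)
    show "(SUP n\<in>{m..}. ereal (a n)) \<le> (SUP M. SUP n\<in>{m..m + M}. ereal (a n))"
    proof (rule SUP_least)
      fix n assume "n \<in> {m..}"
      then show "ereal (a n) \<le> (SUP M. SUP n\<in>{m..m + M}. ereal (a n))"
        by (intro SUP_upper2[of "n - m" UNIV] SUP_upper) auto
    qed
  qed (intro SUP_least SUP_upper, auto)
  finally show ?thesis unfolding eq .
qed

lemma INF_tail_tendsto: "(\<lambda>m. INF n\<in>{Suc m..}. a n) \<longlonglongrightarrow> liminf a"
  and SUP_tail_tendsto: "(\<lambda>m. SUP n\<in>{Suc m..}. a n) \<longlonglongrightarrow> limsup a"
  for a :: "nat \<Rightarrow> ereal"
proof -
  have "incseq (\<lambda>m. INF n\<in>{m..}. a n)"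
    by (auto simp: incseq_def intro!: INF_superset_mono)
  from LIMSEQ_Suc[OF LIMSEQ_SUP[OF this]]
  show "(\<lambda>m. INF n\<in>{Suc m..}. a n) \<longlonglongrightarrow> liminf a"
    by (simp add: liminf_SUP_INF)
  have "decseq (\<lambda>m. SUP n\<in>{m..}. a n)"
    by (auto simp: decseq_def intro!: SUP_subset_mono)
  from LIMSEQ_Suc[OF LIMSEQ_INF[OF this]]
  show "(\<lambda>m. SUP n\<in>{Suc m..}. a n) \<longlonglongrightarrow> limsup a"
    by (simp add: limsup_INF_SUP)
qed

text \<open>All averages in the window are over at least \<open>m + 1\<close> terms, so their square roots share the
  constant \<open>1 / sqrt (m + 1)\<close>, and so does the square root of their minimum or maximum.\<close>

lemma capped_extremum_lipschitz:
  assumes ext: "ext = Min \<or> ext = Max" and d: "0 \<le> d"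
  shows "\<bar>min \<bar>ext ((\<lambda>n. avg_sq p i n z) ` {Suc m..Suc m + M}) - d\<bar> 1 -
      min \<bar>ext ((\<lambda>n. avg_sq p i n z') ` {Suc m..Suc m + M}) - d\<bar> 1\<bar> \<le>
    2 * sqrt (d + 1) / sqrt (real (Suc m)) * (\<Sum>n=1..2 * (Suc m + M) + i. \<bar>z n - z' n\<bar>)"
proof -
  define J where "J = {Suc m..Suc m + M}"
  have J: "finite J" "J \<noteq> {}" by (auto simp: J_def)
  let ?a = "\<lambda>z n. avg_sq p i n z"
  let ?S = "\<Sum>n=1..2 * (Suc m + M) + i. \<bar>z n - z' n\<bar>"
  have nonneg: "0 \<le> ext (?a z ` J)" for z
  proof -
    have "finite (?a z ` J)" "?a z ` J \<noteq> {}" using J by auto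
    then have "ext (?a z ` J) \<in> ?a z ` J" using ext Min_in Max_in by metis
    then show ?thesis using avg_sq_nonneg by auto
  qed
  have "mono sqrt" by (auto simp: mono_def)
  note sqrt_ext = extremum_mono_commute[OF this J]
  have commute: "sqrt (ext (?a z ` J)) = ext ((\<lambda>n. sqrt (?a z n)) ` J)" for z
    using ext sqrt_ext[of "?a z"] by auto
  have "\<bar>ext ((\<lambda>n. sqrt (?a z n)) ` J) - ext ((\<lambda>n. sqrt (?a z' n)) ` J)\<bar> \<le> 1 / sqrt (real (Suc m)) * ?S"
  proof (rule extremum_nonexpansive[OF ext J])
    fix n assume n: "n \<in> J"
    have "(\<Sum>k=1..n. \<bar>z (2 * k + i) - z' (2 * k + i)\<bar>) = (\<Sum>j\<in>(\<lambda>k. 2 * k + i) ` {1..n}. \<bar>z j - z' j\<bar>)"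
      by (subst sum.reindex) (auto simp: inj_on_def)
    also have "\<dots> \<le> ?S"
      using n by (intro sum_mono2) (auto simp: J_def)
    finally have S: "(\<Sum>k=1..n. \<bar>z (2 * k + i) - z' (2 * k + i)\<bar>) \<le> ?S" .
    have "1 / sqrt (real n) \<le> 1 / sqrt (real (Suc m))"
      using n by (intro divide_left_mono) (auto simp: J_def)
    then have "1 / sqrt (real n) * (\<Sum>k=1..n. \<bar>z (2 * k + i) - z' (2 * k + i)\<bar>) \<le> 1 / sqrt (real (Suc m)) * ?S"
      by (intro mult_mono S) (auto intro: sum_nonneg)
    with sqrt_avg_sq_lipschitz show "\<bar>sqrt (?a z n) - sqrt (?a z' n)\<bar> \<le> 1 / sqrt (real (Suc m)) * ?S"
      by (rule order_trans)
  qed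
  then have "\<bar>sqrt (ext (?a z ` J)) - sqrt (ext (?a z' ` J))\<bar> \<le> 1 / sqrt (real (Suc m)) * ?S"
    unfolding commute .
  then have "2 * sqrt (d + 1) * \<bar>sqrt (ext (?a z ` J)) - sqrt (ext (?a z' ` J))\<bar> \<le>
      2 * sqrt (d + 1) * (1 / sqrt (real (Suc m)) * ?S)"
    using d by (intro mult_left_mono) auto
  with capped_distance_lipschitz[OF nonneg nonneg d, of z z']
  show ?thesis unfolding J_def by simp
qed

section \<open>The expected capped deviations are constant\<close>

context observed_process
begin

lemma capped_extremum_limit_constant:
  assumes ext: "ext = Min \<or> ext = Max" and d: "0 \<le> d"
    and lim1: "\<And>a m. (\<lambda>M. ereal (ext (a ` {Suc m..Suc m + M}))) \<longlonglongrightarrow> l1 m a"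
    and lim2: "\<And>a. (\<lambda>m. l1 m a) \<longlonglongrightarrow> l2 a"
  shows "(\<lambda>\<omega>. capped_deviation d (l2 (\<lambda>n. avg_Z P \<Phi> g p i n \<omega>))) \<in> borel_measurable (Pr x)"
    and "(\<integral>\<omega>. capped_deviation d (l2 (\<lambda>n. avg_Z P \<Phi> g p i n \<omega>)) \<partial>Pr x) =
      (\<integral>\<omega>. capped_deviation d (l2 (\<lambda>n. avg_Z P \<Phi> g p i n \<omega>)) \<partial>Pr y)"
proof -
  let ?a = "\<lambda>z n. avg_sq p i n z"
  define \<Theta> where "\<Theta> m M z = min \<bar>ext (?a z ` {Suc m..Suc m + M}) - d\<bar> 1" for m M z
  define \<epsilon> where "\<epsilon> m = 2 * sqrt (d + 1) / sqrt (real (Suc m))" for m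
  have avg: "avg_Z P \<Phi> g p i n \<omega> = ?a (\<lambda>n. Z P \<Phi> g n \<omega>) n" for n \<omega>
    by (simp add: avg_Z_def avg_sq_def)
  have "filterlim (\<lambda>m. sqrt (real (Suc m))) at_top sequentially"
    by (intro filterlim_compose[OF sqrt_at_top] filterlim_compose[OF filterlim_real_sequentially filterlim_Suc])
  then have \<epsilon>: "\<epsilon> \<longlonglongrightarrow> 0"
    unfolding \<epsilon>_def by (intro real_tendsto_divide_at_top[OF tendsto_const])
  have \<epsilon>0: "0 \<le> \<epsilon> m" for m using d by (simp add: \<epsilon>_def)
  have lip: "\<bar>\<Theta> m M z - \<Theta> m M z'\<bar> \<le> \<epsilon> m * (\<Sum>n=1..2 * (Suc m + M) + i. \<bar>z n - z' n\<bar>)" for m M z z'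
    unfolding \<Theta>_def \<epsilon>_def by (rule capped_extremum_lipschitz[OF ext d])
  have bound: "\<bar>\<Theta> m M z\<bar> \<le> 1" for m M z
    by (auto simp: \<Theta>_def)
  have l1: "(\<lambda>M. \<Theta> m M z) \<longlonglongrightarrow> capped_deviation d (l1 m (?a z))" for m z
    using capped_deviation_tendsto[OF lim1, of d "?a z" m] by (simp add: capped_deviation_ereal \<Theta>_def)
  have l2: "(\<lambda>m. capped_deviation d (l1 m (?a z))) \<longlonglongrightarrow> capped_deviation d (l2 (?a z))" for z
    by (rule capped_deviation_tendsto[OF lim2])
  note tail_functional_independent_of_start[OF lip \<epsilon>0 \<epsilon> bound l1 l2]
  then show "(\<lambda>\<omega>. capped_deviation d (l2 (\<lambda>n. avg_Z P \<Phi> g p i n \<omega>))) \<in> borel_measurable (Pr x)"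
    and "(\<integral>\<omega>. capped_deviation d (l2 (\<lambda>n. avg_Z P \<Phi> g p i n \<omega>)) \<partial>Pr x) =
      (\<integral>\<omega>. capped_deviation d (l2 (\<lambda>n. avg_Z P \<Phi> g p i n \<omega>)) \<partial>Pr y)"
    unfolding avg by blast+
qed

lemma expectation_capped_deviation_bounds:
  assumes "(\<lambda>\<omega>. capped_deviation d (X \<omega>)) \<in> borel_measurable (Pr x)"
  shows "(\<integral>\<omega>. capped_deviation d (X \<omega>) \<partial>Pr x) \<in> {0..1}"
  using Pr.abs_integral_le_const(2)[OF assms, of 1] capped_deviation_bounds
  by (auto simp: abs_le_iff)

lemma I_fun_constant:
  assumes d: "0 \<le> d"
  shows "I_fun P \<Phi> Pr g p d i x \<in> {0..1}" "I_fun P \<Phi> Pr g p d i x = I_fun P \<Phi> Pr g p d i y"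
proof -
  note * = capped_extremum_limit_constant[of Min d, OF _ d Min_window_tendsto INF_tail_tendsto, where p = p and i = i]
  show "I_fun P \<Phi> Pr g p d i x \<in> {0..1}"
    unfolding I_fun_def capped_deviation_def[symmetric]
    by (rule expectation_capped_deviation_bounds) (simp add: *(1))
  show "I_fun P \<Phi> Pr g p d i x = I_fun P \<Phi> Pr g p d i y"
    unfolding I_fun_def capped_deviation_def[symmetric] by (simp add: *(2)[of x y])
qed

lemma S_fun_constant:
  assumes d: "0 \<le> d"
  shows "S_fun P \<Phi> Pr g p d i x \<in> {0..1}" "S_fun P \<Phi> Pr g p d i x = S_fun P \<Phi> Pr g p d i y"
proof -
  note * = capped_extremum_limit_constant[of Max d, OF _ d Max_window_tendsto SUP_tail_tendsto, where p = p and i = i]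
  show "S_fun P \<Phi> Pr g p d i x \<in> {0..1}"
    unfolding S_fun_def capped_deviation_def[symmetric]
    by (rule expectation_capped_deviation_bounds) (simp add: *(1))
  show "S_fun P \<Phi> Pr g p d i x = S_fun P \<Phi> Pr g p d i y"
    unfolding S_fun_def capped_deviation_def[symmetric] by (simp add: *(2)[of x y])
qed

end

section \<open>From the Wasserstein distance to integrals of Lipschitz functions\<close>

lemma lipschitz_of_Lip:
  assumes "Lip f < \<infinity>"
  shows "\<bar>f x - f y\<bar> \<le> enn2real (Lip f) * dist x y"
proof (cases "x = y")
  case False
  have "ennreal (\<bar>f x - f y\<bar> / dist x y) \<le> Lip f"
    unfolding Lip_def by (rule SUP_upper2[of "(x, y)"]) (use False in auto)
  also have "Lip f = ennreal (enn2real (Lip f))"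
    using assms by simp
  finally have "\<bar>f x - f y\<bar> / dist x y \<le> enn2real (Lip f)"
    by (simp add: ennreal_le_iff)
  then show ?thesis using False by (simp add: divide_le_eq)
qed simp

text \<open>After division by \<open>L\<close> the function \<open>f\<close> competes in the supremum that defines \<open>d_W\<close>.  For \<open>L = 0\<close> the
  function is constant, and its integrals agree since the kernels are probability measures.\<close>

lemma (in markov_semigroup) wasserstein_contraction_integral:
  assumes W: "d_W (measure_act (return borel x) P t) (measure_act (return borel y) P t) \<le> ennreal r"
    and t: "0 \<le> t" and r: "0 \<le> r" and L: "0 \<le> L" and f: "\<And>x y. \<bar>f x - f y\<bar> \<le> L * dist x y"
  shows "\<bar>(\<integral>z. f z \<partial>P t x) - (\<integral>z. f z \<partial>P t y)\<bar> \<le> L * r"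
proof (cases "L = 0")
  case True
  have "f = (\<lambda>_. f undefined)" using f[of _ undefined] True by auto
  moreover have "(\<integral>z. f undefined \<partial>P t x) = f undefined" for x
    using prob_space.prob_space[OF prob_space_transition[OF t, of x]] by simp
  ultimately have "(\<integral>z. f z \<partial>P t x) = f undefined" for x by metis
  then show ?thesis using True by simp
next
  case False
  with L have L: "0 < L" by simp
  have act: "measure_act (return borel x) P t = P t x" for x
    unfolding measure_act_def by (rule bind_return[OF kernel_subprob[OF t]]) simp
  have "Lip (\<lambda>z. f z / L) \<le> 1"
    unfolding Lip_def
  proof (rule SUP_least)
    fix q :: "'a \<times> 'a" assume "q \<in> {(x, y). x \<noteq> y}"
    then obtain u v where q: "q = (u, v)" "u \<noteq> v" by auto
    then have "\<bar>f u / L - f v / L\<bar> / dist u v \<le> 1"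
      using f[of u v] L by (simp add: divide_le_eq mult.commute flip: diff_divide_distrib)
    then show "(case q of (x, y) \<Rightarrow> ennreal (\<bar>f x / L - f y / L\<bar> / dist x y)) \<le> 1"
      by (simp add: q ennreal_le_1)
  qed
  then have "ennreal \<bar>(\<integral>z. f z / L \<partial>P t x) - (\<integral>z. f z / L \<partial>P t y)\<bar> \<le> d_W (P t x) (P t y)"
    unfolding d_W_def by (intro SUP_upper2[of "\<lambda>z. f z / L"]) auto
  also have "\<dots> \<le> ennreal r" using W unfolding act .
  finally have "\<bar>(\<integral>z. f z / L \<partial>P t x) - (\<integral>z. f z / L \<partial>P t y)\<bar> \<le> r"
    using r by (simp add: ennreal_le_iff)
  then show ?thesis
    using L by (simp add: divide_le_eq mult.commute flip: diff_divide_distrib)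
qed

theorem lemma4p5:
  fixes P :: "real \<Rightarrow> 'a::{complete_space, second_countable_topology} \<Rightarrow> 'a measure"
    and \<Omega> :: "'w set"
    and \<Phi> :: "real \<Rightarrow> 'w \<Rightarrow> 'a"
    and \<theta> :: "real \<Rightarrow> 'w \<Rightarrow> 'w"
    and Pr :: "'a \<Rightarrow> 'w measure"
    and \<mu> \<mu>s :: "'a measure"
    and g :: "'a \<Rightarrow> real"
    and p :: enat and d :: real and i :: nat
  assumes "markov_process P \<Omega> \<Phi> \<theta> Pr"
    and "stochastically_continuous P"
    and "feller P"
    and "wasserstein_contractive P"
    and "\<mu> \<in> M1" and "moment_bounded P \<mu>"
    and "invariant_measure P \<mu>s"
    and "g \<in> BL" and "(\<integral>x. g x \<partial>\<mu>s) = 0"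
    and "d \<ge> 0" and "i \<in> {0, 1}"
  shows "I_fun P \<Phi> Pr g p d i \<in> UNIV \<rightarrow> {0..1} \<and> continuous_on UNIV (I_fun P \<Phi> Pr g p d i) \<and>
         S_fun P \<Phi> Pr g p d i \<in> UNIV \<rightarrow> {0..1} \<and> continuous_on UNIV (S_fun P \<Phi> Pr g p d i)"
proof -
  interpret markov_process P \<Omega> \<Phi> \<theta> Pr by fact
  obtain \<gamma> where \<gamma>: "0 < \<gamma>" and W: "\<And>t x y. 0 \<le> t \<Longrightarrow>
      d_W (measure_act (return borel x) P t) (measure_act (return borel y) P t) \<le> ennreal (exp (- \<gamma> * t) * dist x y)"
    using \<open>wasserstein_contractive P\<close> unfolding wasserstein_contractive_def by blast
  obtain C where C: "\<And>x. \<bar>g x\<bar> \<le> C"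
    using \<open>g \<in> BL\<close> by (auto simp: BL_def bounded_iff)
  have Lip: "Lip g < \<infinity>" using \<open>g \<in> BL\<close> by (simp add: BL_def)
  interpret observed_process P \<Omega> \<Phi> \<theta> Pr \<gamma> g "enn2real (Lip g)" C
  proof unfold_locales
    show "\<bar>(\<integral>z. f z \<partial>P t x) - (\<integral>z. f z \<partial>P t y)\<bar> \<le> L * exp (- \<gamma> * t) * dist x y"
      if "0 \<le> t" "0 \<le> L" "\<And>x y. \<bar>f x - f y\<bar> \<le> L * dist x y" for t L f x y
      using wasserstein_contraction_integral[OF W[OF that(1)] that(1) _ that(2,3), of x y] by (simp add: mult.assoc)
  qed (use \<gamma> C \<open>stochastically_continuous P\<close> lipschitz_of_Lip[OF Lip] in auto)
  have "I_fun P \<Phi> Pr g p d i = (\<lambda>_. I_fun P \<Phi> Pr g p d i undefined)"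
    "S_fun P \<Phi> Pr g p d i = (\<lambda>_. S_fun P \<Phi> Pr g p d i undefined)"
    using I_fun_constant(2) S_fun_constant(2) \<open>d \<ge> 0\<close> by blast+
  then have "continuous_on UNIV (I_fun P \<Phi> Pr g p d i)" "continuous_on UNIV (S_fun P \<Phi> Pr g p d i)"
    by (metis continuous_on_const)+
  with I_fun_constant(1) S_fun_constant(1) \<open>d \<ge> 0\<close> show ?thesis by blast
qed

end
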